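(* Let $n\ge 1$, $V=\mathbb{C}^{2n}$, and let $\widetilde{G}=\mathrm{GL}_{2n}(\mathbb{C})$ act on $\widetilde{L}=V\oplus V^{*}\oplus\mathfrak{gl}_{2n}(\mathbb{C})$ by the action specified in the context. Let $G=\mathrm{Sp}_{2n}(\mathbb{C})\subset\widetilde{G}$, and let $L=V\oplus\mathfrak{sp}_{2n}(\mathbb{C})$ be regarded as the $G$-stable subspace $\{((u,-{}^t u),A) : u\in V,\ A\in\mathfrak{sp}_{2n}(\mathbb{C})\}$ of $\widetilde{L}$. Then the natural map of orbit spaces $$L/G=\bigl(V\oplus\mathfrak{sp}_{2n}(\mathbb{C})\bigr)/\mathrm{Sp}_{2n}(\mathbb{C})\longrightarrow \bigl(V\oplus V^{*}\oplus\mathfrak{gl}_{2n}(\mathbb{C})\bigr)/\mathrm{GL}_{2n}(\mathbb{C})=\widetilde{L}/\widetilde{G},\qquad G\cdot x\mapsto\widetilde{G}\cdot x ,$$ is injective. In particular, for every $\mathrm{GL}_{2n}(\mathbb{C})$-orbit $\mathbb{O}\subset\widetilde{L}$, the intersection $\mathbb{O}\cap L$ is either empty or a single $\mathrm{Sp}_{2n}(\mathbb{C})$-orbit. Moreover, this map takes closed $G$-orbits in $L$ to closed $\widetilde{G}$-orbits in $\widetilde{L}$.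
   Context: Let $J=\begin{pmatrix}0&1_n\\-1_n&0\end{pmatrix}$ and $\langle u,v\rangle={}^t u J v$ on $V=\mathbb{C}^{2n}$. For $g\in\widetilde{G}=\mathrm{GL}_{2n}(\mathbb{C})$ put $\sigma(g)=J^{-1}\,{}^t g\,J$ and $\theta(g)=\sigma(g)^{-1}$. Then $\mathrm{Sp}_{2n}(\mathbb{C})=\{g\in\widetilde{G}: \theta(g)=g\}$, and $\mathfrak{sp}_{2n}(\mathbb{C})=\{A\in\mathfrak{gl}_{2n}(\mathbb{C}) : J^{-1}\,{}^tA\,J=-A\}$. Elements of $V\oplus V^{*}$ are written $(u,{}^t v)$ with $u,v\in\mathbb{C}^{2n}$. The action of $g\in\widetilde{G}$ on $\widetilde{L}$ is $$g\cdot\bigl((u,{}^t v),A\bigr)=\bigl((gu,{}^t(\theta(g)v)),\,gAg^{-1}\bigr);$$ here the action on the second summand is isomorphic to the usual dual representation $V^{*}$ (with ${}^t v$ corresponding to the functional $w\mapsto{}^t vJw$). On $V\oplus\mathfrak{sp}_{2n}(\mathbb{C})$ the group $G$ acts by $g\cdot(u,A)=(gu,gAg^{-1})$, which agrees, under the identification of $(u,A)$ with $((u,-{}^t u),A)$, with the restriction to $G$ and $L$ of the action $g\cdot((u,{}^t v),A)=((gu,{}^t(\theta(g)v)),gAg^{-1})$ of $\widetilde{G}$ on $\widetilde{L}$. For a group $H$ acting on $M$, $M/H$ denotes the set of $H$-orbits. Closedness is with respect to the Zariski topology. *)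

theory Defs
  imports "HOL-Analysis.Analysis" "HOL-Algebra.Group_Action"
begin

text \<open>The index type \<open>'n + 'n\<close> has \<open>2n\<close> elements for \<open>n = CARD('n) \<ge> 1\<close>; the summands
  \<open>Inl\<close> and \<open>Inr\<close> give the two blocks of \<open>J\<close>.\<close>

type_synonym 'n vec2 = "complex^('n + 'n)"
type_synonym 'n mat2 = "complex^('n + 'n)^('n + 'n)"

text \<open>An element \<open>((u, v), A)\<close> stands for \<open>((u, \<^sup>tv), A)\<close> in the sum of \<open>V\<close>, its dual and
  \<open>gl\<^sub>2\<^sub>n\<close>: the row vector is represented by the column vector \<open>v\<close>.\<close>

type_synonym 'n big = "('n vec2 \<times> 'n vec2) \<times> 'n mat2"

definition J :: "'n::finite mat2" where
  "J = (\<chi> i j. case (i, j) of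
          (Inl a, Inr b) \<Rightarrow> if a = b then 1 else 0
        | (Inr a, Inl b) \<Rightarrow> if a = b then - 1 else 0
        | _ \<Rightarrow> 0)"

definition sp_sigma :: "'n::finite mat2 \<Rightarrow> 'n mat2" where
  "sp_sigma g = matrix_inv J ** transpose g ** J"

definition sp_theta :: "'n::finite mat2 \<Rightarrow> 'n mat2" where
  "sp_theta g = matrix_inv (sp_sigma g)"

definition GL :: "'n::finite mat2 monoid" where
  "GL = \<lparr>carrier = {g. invertible g}, mult = (**), one = mat 1\<rparr>"

definition Sp :: "'n::finite mat2 monoid" where
  "Sp = GL\<lparr>carrier := {g \<in> carrier GL. sp_theta g = g}\<rparr>"

definition sp_lie :: "'n::finite mat2 set" where
  "sp_lie = {A. matrix_inv J ** transpose A ** J = - A}"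

definition act :: "'n::finite mat2 \<Rightarrow> 'n big \<Rightarrow> 'n big" where
  "act g = (\<lambda>((u, v), A). ((g *v u, sp_theta g *v v), g ** A ** matrix_inv g))"

definition L_space :: "'n::finite big set" where
  "L_space = {((u, - u), A) | u A. A \<in> sp_lie}"

text \<open>The natural map of orbit spaces, as saturation of an \<open>Sp\<close>-orbit under \<open>GL\<close>; see
  \<open>orbit_map_orbit\<close> below.\<close>

definition orbit_map :: "'n::finite big set \<Rightarrow> 'n big set" where
  "orbit_map O1 = (\<Union>x\<in>O1. orbit GL act x)"

inductive poly_fun :: "('n::finite big \<Rightarrow> complex) \<Rightarrow> bool" where
  const: "poly_fun (\<lambda>x. c)"
| coord_u: "poly_fun (\<lambda>((u, v), A). u $ i)"
| coord_v: "poly_fun (\<lambda>((u, v), A). v $ i)"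
| coord_A: "poly_fun (\<lambda>((u, v), A). A $ i $ j)"
| add: "poly_fun f \<Longrightarrow> poly_fun g \<Longrightarrow> poly_fun (\<lambda>x. f x + g x)"
| mult: "poly_fun f \<Longrightarrow> poly_fun g \<Longrightarrow> poly_fun (\<lambda>x. f x * g x)"

definition zero_locus :: "('n::finite big \<Rightarrow> complex) set \<Rightarrow> 'n big set" where
  "zero_locus S = {x. \<forall>f\<in>S. f x = 0}"

definition zariski :: "'n::finite big topology" where
  "zariski = topology (\<lambda>U. \<exists>S. (\<forall>f\<in>S. poly_fun f) \<and> U = - zero_locus S)"

lemma istopology_zariski:
  "istopology (\<lambda>U::'n::finite big set. \<exists>S. (\<forall>f\<in>S. poly_fun f) \<and> U = - zero_locus S)"
  unfolding istopology_def
proof (intro conjI allI impI)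
  fix U W :: "'n big set"
  assume "\<exists>S. (\<forall>f\<in>S. poly_fun f) \<and> U = - zero_locus S"
    and "\<exists>S. (\<forall>f\<in>S. poly_fun f) \<and> W = - zero_locus S"
  then obtain S T where S: "\<forall>f\<in>S. poly_fun f" "U = - zero_locus S"
    and T: "\<forall>f\<in>T. poly_fun f" "W = - zero_locus T" by blast
  let ?P = "{\<lambda>x. f x * g x | f g. f \<in> S \<and> g \<in> T}"
  have "zero_locus S \<union> zero_locus T = zero_locus ?P"
    unfolding zero_locus_def by (fastforce simp: mult_eq_0_iff)
  moreover have "\<forall>f\<in>?P. poly_fun f"
    using S T by (auto intro: poly_fun.mult)
  ultimately show "\<exists>S. (\<forall>f\<in>S. poly_fun f) \<and> U \<inter> W = - zero_locus S"
    using S T by (intro exI[of _ ?P]) auto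
next
  fix K :: "'n big set set"
  assume "\<forall>U\<in>K. \<exists>S. (\<forall>f\<in>S. poly_fun f) \<and> U = - zero_locus S"
  then obtain S where S: "\<And>U. U \<in> K \<Longrightarrow> (\<forall>f\<in>S U. poly_fun f) \<and> U = - zero_locus (S U)"
    by metis
  have "\<Union>K = (\<Union>U\<in>K. - zero_locus (S U))"
    using S by blast
  also have "\<dots> = - zero_locus (\<Union>U\<in>K. S U)"
    unfolding zero_locus_def by blast
  finally show "\<exists>S. (\<forall>f\<in>S. poly_fun f) \<and> \<Union>K = - zero_locus S"
    using S by (intro exI[of _ "\<Union>U\<in>K. S U"]) auto
qed

lemma closedin_zariski_iff:
  "closedin zariski C \<longleftrightarrow> (\<exists>S. (\<forall>f\<in>S. poly_fun f) \<and> C = zero_locus S)"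
proof -
  have op: "openin zariski U \<longleftrightarrow> (\<exists>S. (\<forall>f\<in>S. poly_fun f) \<and> U = - zero_locus S)"
    for U :: "'a big set"
    unfolding zariski_def by (simp add: topology_inverse'[OF istopology_zariski])
  have "openin zariski (UNIV :: 'a big set)"
    unfolding op zero_locus_def
    by (intro exI[of _ "{\<lambda>x. 1}"]) (auto intro: poly_fun.const)
  then have top: "topspace (zariski :: 'a big topology) = UNIV"
    using openin_subset by blast
  have "UNIV - C = - zero_locus S \<longleftrightarrow> C = zero_locus S" for S :: "('a big \<Rightarrow> complex) set"
    by blast
  then show ?thesis
    unfolding closedin_def op top by auto
qed

lemma matrix_inv_unique:
  fixes A B :: "'a::semiring_1^'m^'m"
  assumes "A ** B = mat 1" "B ** A = mat 1"
  shows "matrix_inv A = B"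
proof -
  have "A ** matrix_inv A = mat 1 \<and> matrix_inv A ** A = mat 1"
    unfolding matrix_inv_def by (rule someI[of _ B]) (simp add: assms)
  then show ?thesis
    by (metis assms(2) matrix_mul_assoc matrix_mul_lid matrix_mul_rid)
qed

lemma matrix_inv_cancel:
  fixes A :: "'a::semiring_1^'m^'m"
  assumes "invertible A"
  shows "A ** matrix_inv A = mat 1" "matrix_inv A ** A = mat 1"
  using assms matrix_inv_unique unfolding invertible_def by metis+

lemma matrix_inv_cancel_left:
  fixes A :: "'a::semiring_1^'m^'m"
  assumes "invertible A"
  shows "A ** (matrix_inv A ** B) = B" "matrix_inv A ** (A ** B) = B"
  by (simp_all add: matrix_mul_assoc matrix_inv_cancel[OF assms])

lemma invertible_mat_1: "invertible (mat 1 :: 'a::semiring_1^'m^'m)"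
  unfolding invertible_def by (intro exI[of _ "mat 1"]) simp

lemma invertible_inv:
  fixes A :: "'a::semiring_1^'m^'m"
  assumes "invertible A"
  shows "invertible (matrix_inv A)"
  using matrix_inv_cancel[OF assms] unfolding invertible_def by blast

lemma matrix_inv_mult:
  fixes A B :: "'a::semiring_1^'m^'m"
  assumes "invertible A" "invertible B"
  shows "matrix_inv (A ** B) = matrix_inv B ** matrix_inv A"
  by (rule matrix_inv_unique)
    (simp_all add: matrix_mul_assoc[symmetric] matrix_inv_cancel_left matrix_inv_cancel assms)

lemma sum_UNIV_sum:
  fixes f :: "'n::finite + 'n \<Rightarrow> complex"
  shows "(\<Sum>k\<in>UNIV. f k) = (\<Sum>a\<in>UNIV. f (Inl a)) + (\<Sum>b\<in>UNIV. f (Inr b))"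
  using sum.Plus[of "UNIV :: 'n set" "UNIV :: 'n set" f] by (simp add: UNIV_Plus_UNIV)

lemma J_squared: "J ** J = - (mat 1 :: 'n::finite mat2)"
proof -
  have "(J ** J) $ i $ j = (- (mat 1 :: 'n mat2)) $ i $ j" for i j :: "'n + 'n"
    by (cases i; cases j)
      (simp_all add: J_def matrix_matrix_mult_def mat_def sum_UNIV_sum
        if_distrib[of "\<lambda>x. x * _"] cong: if_cong)
  then show ?thesis by (simp add: vec_eq_iff)
qed

lemma minus_J: "(J :: 'n::finite mat2) ** (- J) = mat 1" "(- J) ** (J :: 'n mat2) = mat 1"
proof -
  have "X ** (- Y) = - (X ** Y)" "(- X) ** Y = - (X ** Y)" for X Y :: "'n mat2"
    by (simp_all add: matrix_matrix_mult_def vec_eq_iff sum_negf)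
  then show "(J :: 'n mat2) ** (- J) = mat 1" "(- J) ** (J :: 'n mat2) = mat 1"
    by (simp_all add: J_squared)
qed

lemma inv_J: "matrix_inv J = - (J :: 'n::finite mat2)"
  by (rule matrix_inv_unique[OF minus_J])

lemma invertible_J: "invertible (J :: 'n::finite mat2)"
  using minus_J unfolding invertible_def by blast

lemma sp_sigma_mult: "sp_sigma (g ** h) = sp_sigma h ** sp_sigma g"
  unfolding sp_sigma_def matrix_transpose_mul
  by (simp add: matrix_mul_assoc[symmetric] matrix_inv_cancel_left invertible_J)

lemma sp_sigma_one: "sp_sigma (mat 1) = mat 1"
  unfolding sp_sigma_def by (simp add: transpose_mat invertible_J matrix_inv_cancel)

lemma invertible_sp_sigma:
  assumes "invertible g"
  shows "invertible (sp_sigma g)"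
proof -
  have "sp_sigma g ** sp_sigma (matrix_inv g) = mat 1"
    and "sp_sigma (matrix_inv g) ** sp_sigma g = mat 1"
    by (simp_all add: sp_sigma_mult[symmetric] matrix_inv_cancel[OF assms] sp_sigma_one)
  then show ?thesis unfolding invertible_def by blast
qed

lemma sp_theta_mult:
  assumes "invertible g" "invertible h"
  shows "sp_theta (g ** h) = sp_theta g ** sp_theta h"
  unfolding sp_theta_def sp_sigma_mult
  by (simp add: assms invertible_sp_sigma matrix_inv_mult)

lemma sp_theta_one: "sp_theta (mat 1) = mat 1"
  unfolding sp_theta_def sp_sigma_one by (simp add: matrix_inv_unique)

lemma group_GL: "group (GL :: 'n::finite mat2 monoid)"
proof (rule groupI)
  fix x :: "'n mat2" assume "x \<in> carrier GL"
  then show "\<exists>y\<in>carrier GL. y \<otimes>\<^bsub>GL\<^esub> x = \<one>\<^bsub>GL\<^esub>"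
    by (auto simp: GL_def intro!: bexI[of _ "matrix_inv x"] matrix_inv_cancel invertible_inv)
qed (auto simp: GL_def invertible_mult matrix_mul_assoc invertible_mat_1)

lemma subgroup_Sp: "subgroup (carrier Sp) (GL :: 'n::finite mat2 monoid)"
proof (rule group.subgroupI[OF group_GL])
  show "carrier Sp \<noteq> ({} :: 'n mat2 set)"
    using sp_theta_one invertible_mat_1 by (auto simp: Sp_def GL_def)
next
  fix a :: "'n mat2" assume a: "a \<in> carrier Sp"
  then have i: "invertible a" and t: "sp_theta a = a"
    by (auto simp: Sp_def GL_def)
  have "a \<otimes>\<^bsub>GL\<^esub> matrix_inv a = \<one>\<^bsub>GL\<^esub>"
    using i by (simp add: GL_def matrix_inv_cancel)
  then have e: "inv\<^bsub>GL\<^esub> a = matrix_inv a"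
    using i by (intro group.inv_equality[OF group_GL])
      (auto simp: GL_def matrix_inv_cancel invertible_inv)
  have "a ** sp_theta (matrix_inv a) = mat 1"
    using sp_theta_mult[OF i invertible_inv[OF i]] t
    by (simp add: i matrix_inv_cancel sp_theta_one)
  then have "sp_theta (matrix_inv a) = matrix_inv a"
    using matrix_inv_cancel_left(2)[OF i, of "sp_theta (matrix_inv a)"] by simp
  then show "inv\<^bsub>GL\<^esub> a \<in> carrier Sp"
    unfolding e using i by (simp add: Sp_def GL_def invertible_inv)
qed (auto simp: Sp_def GL_def invertible_mult sp_theta_mult)

lemma act_one: "act (mat 1) x = x"
  by (cases x) (auto simp: act_def sp_theta_one matrix_inv_unique)

lemma act_mult:
  assumes "invertible g" "invertible h"
  shows "act (g ** h) x = act g (act h x)"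
  by (cases x)
    (auto simp: act_def sp_theta_mult assms matrix_vector_mul_assoc matrix_inv_mult matrix_mul_assoc)

lemma group_action_GL: "group_action GL (UNIV :: 'n::finite big set) act"
proof -
  have b: "bij (act g :: 'n big \<Rightarrow> 'n big)" if i: "invertible g" for g
  proof (rule o_bij[of "act (matrix_inv g)"])
    show "act (matrix_inv g) \<circ> act g = id" "act g \<circ> act (matrix_inv g) = id"
      by (simp_all add: fun_eq_iff act_mult[symmetric] i invertible_inv matrix_inv_cancel act_one)
  qed
  then have c: "act g \<in> carrier (BijGroup UNIV)"
    if "g \<in> carrier GL" for g :: "'n mat2"
    using that by (auto simp: BijGroup_def Bij_def GL_def)
  have "act (g \<otimes>\<^bsub>GL\<^esub> h) = act g \<otimes>\<^bsub>BijGroup UNIV\<^esub> act h"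
    if "g \<in> carrier GL" "h \<in> carrier GL" for g h :: "'n mat2"
    using c[OF that(1)] c[OF that(2)] that
    by (auto simp: BijGroup_def compose_def GL_def act_mult fun_eq_iff)
  then show ?thesis
    unfolding group_action_def group_hom_def group_hom_axioms_def
    using c by (auto intro!: homI group_GL group_BijGroup)
qed

text \<open>On the image of \<open>(u, A) \<mapsto> ((u, -u), A)\<close> the group \<open>Sp\<close> acts by \<open>(g u, g A g\<^sup>-\<^sup>1)\<close>.\<close>

lemma act_Sp:
  assumes "g \<in> carrier Sp"
  shows "act g ((u, - u), A) = ((g *v u, - (g *v u)), g ** A ** matrix_inv g)"
proof -
  have "g *v (- u) = - (g *v u)"
    by (simp add: matrix_vector_mult_def vec_eq_iff sum_negf)
  then show ?thesis
    using assms by (simp add: act_def Sp_def)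
qed

lemma sp_lie_conj:
  assumes g: "g \<in> carrier Sp" and A: "A \<in> sp_lie"
  shows "g ** A ** matrix_inv g \<in> sp_lie"
proof -
  have i: "invertible g" and t: "sp_theta g = g"
    using g by (auto simp: Sp_def GL_def)
  have "sp_sigma g ** sp_theta g = mat 1" "sp_theta g ** sp_sigma g = mat 1"
    unfolding sp_theta_def by (simp_all add: i invertible_sp_sigma matrix_inv_cancel)
  then have s: "sp_sigma g = matrix_inv g"
    using t matrix_inv_unique by metis
  have "sp_sigma (matrix_inv g) ** matrix_inv g = mat 1"
    using sp_sigma_mult[of g "matrix_inv g"] i by (simp add: matrix_inv_cancel sp_sigma_one s)
  then have "(sp_sigma (matrix_inv g) ** matrix_inv g) ** g = g"
    by simp
  then have s': "sp_sigma (matrix_inv g) = g"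
    by (simp add: matrix_mul_assoc[symmetric] matrix_inv_cancel i)
  have neg: "X ** (- Y) = - (X ** Y)" "(- X) ** Y = - (X ** Y)" for X Y :: "'a mat2"
    by (simp_all add: matrix_matrix_mult_def vec_eq_iff sum_negf)
  have "sp_sigma A = - A"
    using A by (simp add: sp_lie_def sp_sigma_def)
  then have "sp_sigma (g ** A ** matrix_inv g) = - (g ** A ** matrix_inv g)"
    by (simp add: sp_sigma_mult s s' neg matrix_mul_assoc)
  then show ?thesis
    by (simp add: sp_lie_def sp_sigma_def)
qed

lemma L_space_stable: "g \<in> carrier Sp \<Longrightarrow> x \<in> L_space \<Longrightarrow> act g x \<in> L_space"
  by (auto simp: L_space_def act_Sp sp_lie_conj)

lemma orbit_map_orbit: "orbit_map (orbit Sp act x) = orbit GL act x"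
proof
  show "orbit_map (orbit Sp act x) \<subseteq> orbit GL act x"
  proof
    fix y assume "y \<in> orbit_map (orbit Sp act x)"
    then obtain g h where "invertible g" "invertible h" "y = act h (act g x)"
      by (auto simp: orbit_map_def orbit_def Sp_def GL_def)
    then have "invertible (h ** g)" "y = act (h ** g) x"
      by (simp_all add: act_mult invertible_mult)
    then show "y \<in> orbit GL act x"
      by (auto simp: orbit_def GL_def)
  qed
next
  have "x \<in> orbit Sp act x"
    using act_one[of x, symmetric] invertible_mat_1 sp_theta_one
    by (force simp: orbit_def Sp_def GL_def)
  then show "orbit GL act x \<subseteq> orbit_map (orbit Sp act x)"
    unfolding orbit_map_def by blast
qed

end

theory Submission
  imports Defs "HOL-Computational_Algebra.Fundamental_Theorem_Algebra"
begin

text \<open>Injectivity rests on a polar decomposition.  If \<open>g \<in> GL\<close> carries \<open>x \<in> L\<close> to another point of \<open>L\<close>, then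
  \<open>h = \<sigma>(g) g\<close> stabilises \<open>x\<close> and is self-adjoint for the symplectic form.  Over \<open>\<complex>\<close> the invertible matrix
  \<open>h\<close> has a square root \<open>k = f(h)\<close> with \<open>f\<close> a polynomial and \<open>f(1) = 1\<close> (\<open>matrix_sqrt_polynomial\<close>); being a
  polynomial in \<open>h\<close> it is self-adjoint and stabilises \<open>x\<close>, and then \<open>g k\<^sup>-\<^sup>1\<close> is symplectic and moves \<open>x\<close> to \<open>g x\<close>
  (\<open>GL_conjugate_imp_Sp_conjugate\<close>).  So a \<open>GL\<close>-orbit meets \<open>L\<close> in at most one \<open>Sp\<close>-orbit.

  For closedness, a point of \<open>V \<oplus> V\<^sup>* \<oplus> gl\<close> is regarded as a triple \<open>(u, \<phi>, A)\<close> of a vector, a covector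
  and a matrix.  Call it split if the space is the direct sum of the cyclic subspace of \<open>u\<close> under \<open>A\<close> and the
  common kernel of all functionals \<open>\<phi> A\<^sup>k\<close>, and if \<open>A\<close> is diagonalisable on the latter
  (\<open>split_triple\<close>).  Two facts are combined.

  The \<open>GL\<close>-orbit of a split triple is Zariski closed (\<open>split_orbit_closed\<close>).  The projection onto the cyclic part
  and the projections onto the eigenspaces in the complement are given by polynomial formulas in the triple, with
  fixed constants.  Hence the relations that they satisfy, the moments \<open>\<phi> A\<^sup>k u\<close> and the traces of the
  eigenprojections all persist on the closure of the orbit.  These data determine a split triple up to
  conjugacy (\<open>split_triples_conjugate\<close>): a comparison map given by the same formula identifies the cyclic parts,
  and eigenspaces of equal dimension are isomorphic.

  A closed \<open>Sp\<close>-orbit in \<open>L\<close> consists of split triples (\<open>closed_orbit_split\<close>).  Take an eigenvector \<open>r\<close> of \<open>A\<close>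
  orthogonal to \<open>u\<close> and a vector \<open>s\<close> with \<open>\<langle>r, s\<rangle> = 1\<close>.  The one-parameter subgroup of \<open>Sp\<close> that scales \<open>r\<close> by
  \<open>t\<close> and \<open>s\<close> by \<open>t\<^sup>-\<^sup>1\<close> has a limit at \<open>t = 0\<close> on the given point, and a closed orbit contains this limit
  (\<open>closed_orbit_limit\<close>).  If the cyclic subspace of \<open>u\<close> were degenerate, or \<open>A\<close> not diagonalisable on its
  orthogonal complement, a suitable \<open>r\<close> would make the dimension of the cyclic subspace, or the rank of a
  polynomial in \<open>A\<close>, drop in the limit; but both are constant on the orbit.\<close>

section \<open>Functionals, rank-one matrices and polynomials in a matrix\<close>

type_synonym 'm cvec = "complex^'m"
type_synonym 'm cmat = "complex^'m^'m"

definition dotp :: "'m::finite cvec \<Rightarrow> 'm cvec \<Rightarrow> complex" where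
  "dotp f x = (\<Sum>i\<in>UNIV. f $ i * x $ i)"

text \<open>The rank-one matrix sending \<open>x\<close> to \<open>f(x) a\<close>, where the covector \<open>f\<close> is paired with \<open>x\<close> bilinearly.\<close>

definition outer :: "'m::finite cvec \<Rightarrow> 'm cvec \<Rightarrow> 'm cmat" where
  "outer a f = (\<chi> i j. a $ i * f $ j)"

lemma dotp_simps [simp]:
  "dotp f (x + y) = dotp f x + dotp f y" "dotp f (x - y) = dotp f x - dotp f y"
  "dotp f (c *s x) = c * dotp f x" "dotp f 0 = 0" "dotp f (- x) = - dotp f x"
  "dotp (f + g) x = dotp f x + dotp g x" "dotp (f - g) x = dotp f x - dotp g x"
  "dotp (c *s f) x = c * dotp f x" "dotp 0 x = 0" "dotp (- f) x = - dotp f x"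
  by (simp_all add: dotp_def algebra_simps sum.distrib sum_subtractf sum_distrib_left sum_negf)

lemma dotp_comm: "dotp f x = dotp x f"
  by (simp add: dotp_def mult.commute)

lemma dotp_vm [simp]: "dotp (f v* M) x = dotp f (M *v x)"
proof -
  have "dotp (f v* M) x = (\<Sum>i\<in>UNIV. \<Sum>j\<in>UNIV. f $ j * M $ j $ i * x $ i)"
    by (simp add: dotp_def vector_matrix_mult_def sum_distrib_right)
  also have "\<dots> = dotp f (M *v x)"
    by (subst sum.swap)
      (simp add: dotp_def matrix_vector_mult_def sum_distrib_left mult_ac)
  finally show ?thesis .
qed

lemma dotp_axis: "dotp (axis i 1) x = x $ i" "dotp x (axis i 1) = x $ i"
  by (simp_all add: dotp_def axis_def if_distrib[of "\<lambda>y. y * _"] if_distrib[of "\<lambda>y. _ * y"] cong: if_cong)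

lemma dotp_eqI: "(\<And>x. dotp f x = dotp g x) \<Longrightarrow> f = g"
  by (metis dotp_axis(2) vec_eq_iff)

lemma mat_eqI: "(\<And>x. M *v x = N *v x) \<Longrightarrow> M = N" for M N :: "'m::finite cmat"
  by (simp add: matrix_eq)

lemma outer_mv [simp]: "outer a f *v x = dotp f x *s a"
  by (simp add: vec_eq_iff outer_def matrix_vector_mult_def dotp_def sum_distrib_left mult_ac)

lemma trace_outer: "trace (outer a f) = dotp f a"
  by (simp add: trace_def outer_def dotp_def mult.commute)

lemma mv_simps [simp]:
  fixes M N :: "'m::finite cmat"
  shows "(M ** N) *v x = M *v (N *v x)" "M *v (c *s x) = c *s (M *v x)"
    "(M + N) *v x = M *v x + N *v x" "(M - N) *v x = M *v x - N *v x"
    "M *v (x + y) = M *v x + M *v y" "M *v (x - y) = M *v x - M *v y"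
    "mat c *v x = c *s x" "(- M) *v x = - (M *v x)" "M *v (- x) = - (M *v x)"
  by (simp_all add: matrix_vector_mul_assoc vector_scalar_commute algebra_simps)
    (simp_all add: vec_eq_iff matrix_vector_mult_def mat_def sum_negf
      if_distrib[of "\<lambda>y. y * _"] cong: if_cong)

lemma trace_diff_add:
  fixes M N :: "'m::finite cmat"
  shows "trace (M - N) = trace M - trace N" "trace (M + N) = trace M + trace N" "trace (0::'m cmat) = 0"
  by (simp_all add: trace_def sum.distrib sum_subtractf)

text \<open>The value of \<open>p\<close> at \<open>A\<close>, by Horner's scheme, suited to induction over \<open>pCons\<close>.
  It is not \<open>poly\<close> because \<open>*\<close> on matrices is the entrywise product, whereas powers of \<open>A\<close> are meant with \<open>**\<close>.\<close>

definition mpoly :: "complex poly \<Rightarrow> 'm::finite cmat \<Rightarrow> 'm cmat" where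
  "mpoly p A = fold_coeffs (\<lambda>a B. mat a + A ** B) p 0"

lemma mat_zero: "mat 0 = (0::'m::finite cmat)"
  by (simp add: mat_def vec_eq_iff)

lemma mpoly_0 [simp]: "mpoly 0 A = 0"
  by (simp add: mpoly_def)

lemma mpoly_pCons [simp]: "mpoly (pCons a p) A = mat a + A ** mpoly p A"
proof (cases "p = 0 \<and> a = 0")
  case True
  then show ?thesis by (auto intro: mat_eqI)
next
  case False
  then show ?thesis by (auto simp: mpoly_def)
qed

lemma mpoly_1 [simp]: "mpoly 1 A = mat 1"
  by (rule mat_eqI) (simp add: one_pCons)

lemma mpoly_add [simp]: "mpoly (p + q) A = mpoly p A + mpoly q A"
proof (rule mat_eqI)
  show "mpoly (p + q) A *v x = (mpoly p A + mpoly q A) *v x" for x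
    by (induction p q rule: poly_induct2) (simp_all add: algebra_simps vec.scale_left_distrib)
qed

lemma mpoly_smult [simp]: "mpoly (smult c p) A = mat c ** mpoly p A"
proof (rule mat_eqI)
  show "mpoly (smult c p) A *v x = (mat c ** mpoly p A) *v x" for x
    by (induction p) (simp_all add: vec.scale_right_distrib)
qed

lemma mpoly_mult [simp]: "mpoly (p * q) A = mpoly p A ** mpoly q A"
proof (rule mat_eqI)
  show "mpoly (p * q) A *v x = (mpoly p A ** mpoly q A) *v x" for x
    by (induction p) simp_all
qed

lemma mpoly_minus [simp]: "mpoly (- p) A = - mpoly p A"
  using mpoly_smult[of "-1" p A] by (auto intro!: mat_eqI)

lemma mpoly_diff [simp]: "mpoly (p - q) A = mpoly p A - mpoly q A"
  using mpoly_add[of p "- q" A] by (auto intro!: mat_eqI)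

lemma mpoly_mv_commute: "mpoly p A *v (mpoly q A *v x) = mpoly q A *v (mpoly p A *v x)"
  by (metis mpoly_mult mult.commute mv_simps(1))

lemma mpoly_intertwine:
  fixes g A B :: "'m::finite cmat"
  assumes "\<And>x. B *v (g *v x) = g *v (A *v x)"
  shows "mpoly p B *v (g *v x) = g *v (mpoly p A *v x)"
  by (induction p) (simp_all add: assms)

lemma mpoly_eigen: "A *v r = \<alpha> *s r \<Longrightarrow> mpoly p A *v r = poly p \<alpha> *s r"
  by (induction p) (simp_all add: vec.scale_left_distrib mult.commute)

text \<open>Among the \<open>dim V + 1\<close> vectors \<open>w, A w, A\<^sup>2 w, \<dots>\<close> there is a linear relation.  Should two of them
  coincide, their difference is one; this case is separate because the set of these vectors is then too small.\<close>

lemma vector_annihilator: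
  fixes A :: "'m::finite cmat"
  obtains p where "p \<noteq> 0" "mpoly p A *v w = 0"
proof -
  let ?v = "\<lambda>k. mpoly (monom 1 k) A *v w"
  let ?n = "Suc CARD('m)"
  have ev: "mpoly (\<Sum>k\<in>K. monom (c k) k) A *v w = (\<Sum>k\<in>K. c k *s ?v k)" if "finite K" for c K
    using that
  proof induction
    case (insert k K)
    have "monom (c k) k = smult (c k) (monom 1 k)" by (simp add: smult_monom)
    then show ?case using insert by simp
  qed simp
  show ?thesis
  proof (cases "inj_on ?v {..<?n}")
    case True
    have "vec.dependent (?v ` {..<?n})"
    proof (rule vec.dependent_biggerset_general)
      show "finite (?v ` {..<?n}) \<Longrightarrow> vec.dim (?v ` {..<?n}) < card (?v ` {..<?n})"
        using dim_subset_UNIV_cart_gen[of "?v ` {..<?n}"] card_image[OF True] by simp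
    qed
    then obtain c where c: "\<exists>v\<in>?v ` {..<?n}. c v \<noteq> 0" "(\<Sum>v\<in>?v ` {..<?n}. c v *s v) = 0"
      using vec.dependent_finite[of "?v ` {..<?n}"] by auto
    define p where "p = (\<Sum>k<?n. monom (c (?v k)) k)"
    obtain k where k: "k < ?n" "c (?v k) \<noteq> 0" using c by auto
    have "coeff p k = c (?v k)"
      using k(1) by (simp add: p_def coeff_sum if_distrib cong: if_cong)
    then have "p \<noteq> 0" using k by auto
    moreover have "mpoly p A *v w = 0"
      unfolding p_def using c(2) sum.reindex[OF True, of "\<lambda>v. c v *s v"] by (subst ev) auto
    ultimately show ?thesis using that by blast
  next
    case False
    then obtain j k where "j \<noteq> k" "?v j = ?v k" by (auto simp: inj_on_def)
    moreover have "monom 1 j - monom 1 k \<noteq> (0::complex poly)" if "j \<noteq> k" for j k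
      using that by (simp add: monom_eq_iff')
    ultimately show ?thesis using that[of "monom 1 j - monom 1 k"] by simp
  qed
qed

text \<open>The product of annihilators of the basis vectors annihilates all of them.\<close>

lemma matrix_annihilator:
  fixes A :: "'m::finite cmat"
  obtains p where "p \<noteq> 0" "mpoly p A = 0"
proof -
  have "\<exists>p. p \<noteq> 0 \<and> mpoly p A *v w = 0" for w
    by (rule vector_annihilator[of A w]) blast
  then obtain q where q: "\<And>w. q w \<noteq> 0" "\<And>w. mpoly (q w) A *v w = 0"
    by metis
  define p where "p = (\<Prod>i\<in>UNIV. q (axis i 1))"
  have "mpoly p A *v axis i 1 = 0" for i
  proof -
    have "p = (\<Prod>j\<in>UNIV - {i}. q (axis j 1)) * q (axis i 1)"
      unfolding p_def by (simp add: prod.remove[of UNIV i] mult.commute[of "q (axis i 1)"])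
    then show ?thesis using q by simp
  qed
  moreover have "(M *v axis i 1) $ a = M $ a $ i" for M :: "'m cmat" and a i
    by (simp add: matrix_vector_mult_def axis_def if_distrib[of "\<lambda>y. _ * y"] cong: if_cong)
  ultimately have "mpoly p A = 0"
    by (metis vec_eq_iff zero_index)
  moreover have "p \<noteq> 0" using q by (simp add: p_def)
  ultimately show ?thesis using that by blast
qed

text \<open>Let \<open>p\<close> have least degree among the nonzero polynomials with \<open>p(A) w = 0\<close>, and split off a root:
  \<open>p = (z - \<alpha>) q\<close>.  Then \<open>q(A) w\<close> is nonzero and lies in the kernel of \<open>A - \<alpha>\<close>.  The eigenvector is produced
  in the form \<open>q(A) w\<close> so that it stays in every \<open>A\<close>-stable subspace containing \<open>w\<close>.\<close>

lemma eigenvector_from_cyclic: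
  fixes A :: "'m::finite cmat"
  assumes "w \<noteq> 0"
  obtains q \<alpha> where "mpoly q A *v w \<noteq> 0" "A *v (mpoly q A *v w) = \<alpha> *s (mpoly q A *v w)"
proof -
  define S where "S = {p. p \<noteq> 0 \<and> mpoly p A *v w = 0}"
  have "S \<noteq> {}" using vector_annihilator[of A w] unfolding S_def by blast
  then obtain p where p: "p \<in> S" "\<And>q. q \<in> S \<Longrightarrow> degree p \<le> degree q"
    using ex_has_least_nat[of "\<lambda>p. p \<in> S" _ degree] by blast
  have "degree p \<noteq> 0"
  proof
    assume "degree p = 0"
    then obtain c where "p = [:c:]" by (metis degree_eq_zeroE)
    then show False using p(1) assms by (auto simp: S_def)
  qed
  then obtain \<alpha> where "poly p \<alpha> = 0"
    using fundamental_theorem_of_algebra constant_degree by metis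
  then obtain q where q: "p = [:-\<alpha>, 1:] * q" by (metis dvdE poly_eq_0_iff_dvd)
  have "q \<noteq> 0" using p(1) q by (auto simp: S_def)
  then have "degree q < degree p" unfolding q by (subst degree_mult_eq) auto
  then have "mpoly q A *v w \<noteq> 0" using p(2)[of q] \<open>q \<noteq> 0\<close> by (auto simp: S_def)
  moreover have "mpoly p A *v w = 0" using p(1) by (simp add: S_def)
  then have "A *v (mpoly q A *v w) = \<alpha> *s (mpoly q A *v w)"
    unfolding q mpoly_mult by simp
  ultimately show ?thesis using that by blast
qed

section \<open>Idempotents, dimensions and square roots\<close>

lemma mv_sum: "M *v (\<Sum>i\<in>I. x i) = (\<Sum>i\<in>I. M *v x i)" for M :: "'m::finite cmat"
  by (induction I rule: infinite_finite_induct) simp_all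

lemma sum_mv: "(\<Sum>i\<in>I. M i) *v x = (\<Sum>i\<in>I. M i *v x)" for M :: "'i \<Rightarrow> 'm::finite cmat"
  by (induction I rule: infinite_finite_induct) simp_all

lemma dotp_sum: "dotp f (\<Sum>i\<in>I. x i) = (\<Sum>i\<in>I. dotp f (x i))"
  by (induction I rule: infinite_finite_induct) simp_all

lemma rank_one_sum_mult:
  fixes m :: nat
  assumes "\<And>i j. i < m \<Longrightarrow> j < m \<Longrightarrow> dotp (b i) (c j) = (if i = j then 1 else 0)"
  shows "(\<Sum>i<m. outer (a i) (b i)) ** (\<Sum>i<m. outer (c i) (d i)) = (\<Sum>i<m. outer (a i) (d i))"
proof (rule mat_eqI)
  fix x
  have "dotp (b i) (\<Sum>j<m. dotp (d j) x *s c j) = dotp (d i) x" if "i < m" for i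
    using that by (simp add: dotp_sum assms if_distrib cong: if_cong)
  then show "((\<Sum>i<m. outer (a i) (b i)) ** (\<Sum>i<m. outer (c i) (d i))) *v x
      = (\<Sum>i<m. outer (a i) (d i)) *v x"
    by (simp add: sum_mv)
qed

text \<open>An idempotent is split into rank-one idempotents by removing one at a time: a nonzero vector \<open>w\<close> of
  the image and a functional \<open>\<psi>\<close> with \<open>\<psi>(w) = 1\<close> and \<open>\<psi> E = \<psi>\<close> leave the idempotent \<open>E - w \<otimes> \<psi>\<close>, whose
  image is strictly smaller.\<close>

lemma idempotent_rank_one:
  fixes E :: "'m::finite cmat"
  assumes "E ** E = E"
  shows "\<exists>m f \<psi>. E = (\<Sum>i<m. outer (f i) (\<psi> i)) \<and> m \<le> vec.dim (range ((*v) E)) \<and>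
    (\<forall>i<m. \<forall>j<m. dotp (\<psi> i) (f j) = (if i = j then 1 else 0))"
  using assms
proof (induction "vec.dim (range ((*v) E))" arbitrary: E rule: less_induct)
  case less
  show ?case
  proof (cases "E = 0")
    case True
    then show ?thesis by (intro exI[of _ 0]) simp
  next
    case False
    have EE: "E *v (E *v x) = E *v x" for x
      using less.prems by (metis mv_simps(1))
    obtain y where "E *v y \<noteq> 0" using False by (metis matrix_vector_mult_0 mat_eqI)
    define w where "w = E *v y"
    have w: "E *v w = w" "w \<noteq> 0" using EE \<open>E *v y \<noteq> 0\<close> by (simp_all add: w_def)
    then obtain i where i: "w $ i \<noteq> 0" by (auto simp: vec_eq_iff)
    \<comment> \<open>composing with \<open>E\<close> gives \<open>\<psi>0 E = \<psi>0\<close> and keeps the value at \<open>w = E w\<close>\<close>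
    define \<psi>0 where "\<psi>0 = ((1 / w $ i) *s axis i 1) v* E"
    have \<psi>w: "dotp \<psi>0 w = 1" using i w by (simp add: \<psi>0_def dotp_axis)
    have \<psi>E: "dotp \<psi>0 (E *v x) = dotp \<psi>0 x" for x
      by (simp add: \<psi>0_def EE)
    define F where "F = E - outer w \<psi>0"
    have F: "F *v x = E *v x - dotp \<psi>0 x *s w" for x by (simp add: F_def)
    have Fw: "F *v w = 0" by (simp add: F w \<psi>w)
    have FF: "F ** F = F" by (rule mat_eqI) (simp add: F EE w \<psi>w \<psi>E)
    have EF: "E *v (F *v x) = F *v x" for x by (simp add: F EE w)
    have sub: "range ((*v) F) \<subset> range ((*v) E)"
    proof
      show "range ((*v) F) \<subseteq> range ((*v) E)" using EF by (metis image_subsetI rangeI)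
      have "w \<notin> range ((*v) F)"
      proof
        assume "w \<in> range ((*v) F)"
        then obtain z where "w = F *v z" by blast
        then have "F *v w = w" using FF by (metis mv_simps(1))
        then show False using Fw w by simp
      qed
      moreover have "w \<in> range ((*v) E)" by (simp add: w_def)
      ultimately show "range ((*v) F) \<noteq> range ((*v) E)" by blast
    qed
    have "vec.subspace (range ((*v) M))" for M :: "'m cmat"
      using vec.linear_subspace_image[OF vec.linear_axioms vec.subspace_UNIV, of M] by simp
    then have "vec.dim (range ((*v) F)) < vec.dim (range ((*v) E))"
      using vec.dim_psubset[of "range ((*v) F)" "range ((*v) E)"] sub
      by (simp add: vec.span_eq_iff[THEN iffD2])
    from less.hyps[OF this FF] obtain m f \<psi> where
      IH: "F = (\<Sum>i<m. outer (f i) (\<psi> i))" "m \<le> vec.dim (range ((*v) F))"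
        "\<And>i j. i < m \<Longrightarrow> j < m \<Longrightarrow> dotp (\<psi> i) (f j) = (if i = j then 1 else 0)" by blast
    have Fx: "F *v x = (\<Sum>i<m. dotp (\<psi> i) x *s f i)" for x
      by (simp add: IH(1) sum_mv)
    have "dotp (\<psi> i) (F *v x) = dotp (\<psi> i) x" if "i < m" for i x
      using that by (simp add: Fx dotp_sum IH(3) if_distrib cong: if_cong)
    from this[of _ w] have 1: "dotp (\<psi> i) w = 0" if "i < m" for i
      using that Fw by simp
    have "F *v f j = f j" if "j < m" for j
      using that by (simp add: Fx IH(3) if_distrib[of "\<lambda>y. y *s _"] cong: if_cong)
    moreover have "dotp \<psi>0 (F *v x) = 0" for x by (simp add: F \<psi>E \<psi>w)
    ultimately have 2: "dotp \<psi>0 (f j) = 0" if "j < m" for j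
      using that by metis
    have "E = (\<Sum>i<Suc m. outer ((f(m := w)) i) ((\<psi>(m := \<psi>0)) i))"
      using IH(1) by (simp add: F_def algebra_simps)
    moreover have "Suc m \<le> vec.dim (range ((*v) E))"
      using IH(2) \<open>vec.dim (range ((*v) F)) < vec.dim (range ((*v) E))\<close> by simp
    moreover have "\<forall>i<Suc m. \<forall>j<Suc m. dotp ((\<psi>(m := \<psi>0)) i) ((f(m := w)) j) = (if i = j then 1 else 0)"
      using 1 2 IH(3) \<psi>w by (auto simp: less_Suc_eq)
    ultimately show ?thesis by blast
  qed
qed

lemma trace_rank_one_sum:
  fixes m :: nat
  assumes "\<And>i j. i < m \<Longrightarrow> j < m \<Longrightarrow> dotp (\<psi> i) (f j) = (if i = j then 1 else 0)"
  shows "trace (\<Sum>i<m. outer (f i) (\<psi> i)) = of_nat m"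
proof -
  have "trace (\<Sum>i<k. outer (f i) (\<psi> i)) = (\<Sum>i<k. dotp (\<psi> i) (f i))" for k
    by (induction k) (simp_all add: trace_diff_add trace_outer)
  then show ?thesis using assms by simp
qed

lemma idempotent_trace_bound:
  fixes E :: "'m::finite cmat"
  assumes "E ** E = E"
  obtains m where "trace E = of_nat m" "m \<le> CARD('m)"
proof -
  obtain m f \<psi> where E: "E = (\<Sum>i<m. outer (f i) (\<psi> i))" "m \<le> vec.dim (range ((*v) E))"
    "\<And>i j. i < m \<Longrightarrow> j < m \<Longrightarrow> dotp (\<psi> i) (f j) = (if i = j then 1 else 0)"
    using idempotent_rank_one[OF assms] by blast
  show ?thesis
    using that[of m] E(2) dim_subset_UNIV_cart_gen[of "range ((*v) E)"]
      trace_rank_one_sum[of m \<psi> f] E(1,3) by (metis order_trans)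
qed

text \<open>The trace of an idempotent counts its rank-one summands, so idempotents of equal trace are matched
  summand by summand.  The partial isomorphisms \<open>X\<close>, \<open>Y\<close> between their images are more convenient than a
  conjugating matrix, since those belonging to orthogonal idempotents can simply be added.\<close>

lemma idempotents_equivalent:
  fixes E F :: "'m::finite cmat"
  assumes "E ** E = E" "F ** F = F" "trace E = trace F"
  shows "\<exists>X Y. Y ** X = E \<and> X ** Y = F \<and> F ** X = X \<and> X ** E = X \<and> E ** Y = Y \<and> Y ** F = Y"
proof -
  obtain m f \<psi> where E: "E = (\<Sum>i<m. outer (f i) (\<psi> i))"
    "m \<le> vec.dim (range ((*v) E))"
    "\<And>i j. i < m \<Longrightarrow> j < m \<Longrightarrow> dotp (\<psi> i) (f j) = (if i = j then 1 else 0)"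
    using idempotent_rank_one[OF assms(1)] by blast
  obtain m' g \<eta> where F: "F = (\<Sum>i<m'. outer (g i) (\<eta> i))"
    "m' \<le> vec.dim (range ((*v) F))"
    "\<And>i j. i < m' \<Longrightarrow> j < m' \<Longrightarrow> dotp (\<eta> i) (g j) = (if i = j then 1 else 0)"
    using idempotent_rank_one[OF assms(2)] by blast
  have [simp]: "m' = m"
    using trace_rank_one_sum[of m \<psi> f] trace_rank_one_sum[of m' \<eta> g] E F assms(3) by simp
  define X where "X = (\<Sum>i<m. outer (g i) (\<psi> i))"
  define Y where "Y = (\<Sum>i<m. outer (f i) (\<eta> i))"
  show ?thesis
    by (rule exI[of _ X], rule exI[of _ Y])
      (use F(3) in \<open>simp add: X_def Y_def E(1) F(1) rank_one_sum_mult E(3)\<close>)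
qed

text \<open>If \<open>M\<close> kills a nonzero vector of \<open>S\<close>, then \<open>dim M(S) < dim S = dim g(S)\<close>.  Every contradiction with
  closedness of an orbit below has this form.\<close>

lemma kernel_vector_shrinks:
  fixes g M :: "'m::finite cmat"
  assumes S: "vec.subspace S" and r: "r \<in> S" "r \<noteq> 0" "M *v r = 0"
    and g: "\<And>x. g *v x = 0 \<Longrightarrow> x = 0" and sub: "(*v) g ` S \<subseteq> (*v) M ` S"
  shows False
proof -
  obtain B where B: "{r} \<subseteq> B" "B \<subseteq> S" "vec.independent B" "S \<subseteq> vec.span B"
    using vec.maximal_independent_subset_extend[of "{r}" S] r by auto
  have fin: "finite B" using B(3) vec.finiteI_independent by blast
  have dimS: "vec.dim S = card B" using B vec.dim_unique by blast
  have "(*v) M ` S \<subseteq> vec.span ((*v) M ` B)"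
    using B(4) vec.linear_span_image[OF vec.linear_axioms, of M B] by blast
  also have "(*v) M ` B = insert 0 ((*v) M ` (B - {r}))"
    using B(1) r(3) by force
  finally have "(*v) M ` S \<subseteq> vec.span ((*v) M ` (B - {r}))" by (simp add: vec.span_insert_0)
  then have "vec.dim ((*v) M ` S) \<le> card ((*v) M ` (B - {r}))"
    using fin by (intro vec.dim_le_card) auto
  also have "\<dots> < card B"
    using card_image_le[of "B - {r}" "(*v) M"] fin B(1) card_Diff1_less[of B r] by auto
  finally have "vec.dim ((*v) M ` S) < vec.dim S" using dimS by simp
  moreover have "vec.dim ((*v) g ` S) = vec.dim S"
  proof (rule vec.dim_image_eq[OF vec.linear_axioms])
    show "inj_on ((*v) g) (vec.span S)"
      by (rule inj_onI) (metis g mv_simps(6) right_minus_eq)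
  qed
  ultimately show False using vec.dim_subset[OF sub] by simp
qed

text \<open>The square root of \<open>z\<close> modulo \<open>M\<close> is lifted one linear factor at a time.  Given \<open>f\<^sup>2 - z = N q\<close>, the
  correction \<open>f + c N\<close> satisfies \<open>(f + c N)\<^sup>2 - z = N (q + 2 c f + c\<^sup>2 N)\<close>, and the second factor must vanish
  at the new root \<open>\<mu>\<close>.  This is an equation for the number \<open>c\<close>: if \<open>N(\<mu>) \<noteq> 0\<close> it is quadratic; if
  \<open>N(\<mu>) = 0\<close> it is linear with leading coefficient \<open>2 f(\<mu>)\<close>, where \<open>f(\<mu>)\<^sup>2 = \<mu> \<noteq> 0\<close>.\<close>

lemma poly_sqrt_mod:
  fixes M :: "complex poly"
  assumes "M \<noteq> 0" "\<And>\<mu>. poly M \<mu> = 0 \<Longrightarrow> \<mu> \<noteq> 0"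
  shows "\<exists>f. M dvd f * f - [:0, 1:]"
  using assms
proof (induction "degree M" arbitrary: M rule: less_induct)
  case less
  show ?case
  proof (cases "degree M = 0")
    case True
    then have "is_unit M" using less.prems(1) by (simp add: is_unit_iff_degree)
    then show ?thesis by (meson unit_imp_dvd)
  next
    case False
    then obtain \<mu> where \<mu>: "poly M \<mu> = 0"
      using fundamental_theorem_of_algebra constant_degree by metis
    then obtain N where N: "M = [:-\<mu>, 1:] * N" by (metis dvdE poly_eq_0_iff_dvd)
    have "N \<noteq> 0" using less.prems(1) N by auto
    then have "degree N < degree M" unfolding N by (subst degree_mult_eq) auto
    moreover have "\<And>\<nu>. poly N \<nu> = 0 \<Longrightarrow> \<nu> \<noteq> 0" using less.prems(2) N by auto
    ultimately obtain f where "N dvd f * f - [:0, 1:]"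
      using less.hyps \<open>N \<noteq> 0\<close> by blast
    then obtain q where q: "f * f - [:0, 1:] = N * q" by blast
    have "\<exists>c. poly q \<mu> + 2 * c * poly f \<mu> + c * c * poly N \<mu> = 0"
    proof (cases "poly N \<mu> = 0")
      case True
      have "poly (f * f - [:0, 1:]) \<mu> = 0" unfolding q by (simp add: True)
      then have "poly f \<mu> \<noteq> 0" using less.prems(2)[OF \<mu>] by auto
      then show ?thesis using True by (intro exI[of _ "- poly q \<mu> / (2 * poly f \<mu>)"]) simp
    next
      case False
      then obtain c where "poly [:poly q \<mu>, 2 * poly f \<mu>, poly N \<mu>:] c = 0"
        using fundamental_theorem_of_algebra[of "[:poly q \<mu>, 2 * poly f \<mu>, poly N \<mu>:]"]
        by (auto simp: constant_degree)
      then show ?thesis by (intro exI[of _ c]) (simp add: algebra_simps)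
    qed
    then obtain c where c: "poly q \<mu> + 2 * c * poly f \<mu> + c * c * poly N \<mu> = 0" by blast
    let ?s = "q + smult (2 * c) f + smult (c * c) N"
    let ?f = "f + smult c N"
    have "poly ?s \<mu> = 0" using c by simp
    then obtain t where t: "?s = [:-\<mu>, 1:] * t" by (metis dvdE poly_eq_0_iff_dvd)
    have "?f * ?f - [:0, 1:] = (f * f - [:0, 1:]) + N * (smult (2 * c) f + smult (c * c) N)"
      by (subst poly_eq_poly_eq_iff[symmetric], rule ext) (simp add: algebra_simps)
    also have "\<dots> = N * ?s" unfolding q by (simp add: algebra_simps)
    also have "\<dots> = M * t" unfolding t N by (simp only: mult_ac)
    finally show ?thesis by (metis dvd_triv_left)
  qed
qed

text \<open>An annihilating polynomial of least degree does not vanish at \<open>0\<close> because \<open>h\<close> is invertible.  The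
  extra factor \<open>z - 1\<close> in the modulus forces \<open>f(1) = \<plusminus>1\<close>, and the sign is free; with \<open>f(1) = 1\<close> the root
  \<open>f(h)\<close> fixes every vector that \<open>h\<close> fixes.\<close>

lemma matrix_sqrt_polynomial:
  fixes h :: "'m::finite cmat"
  assumes "invertible h"
  obtains f where "mpoly f h ** mpoly f h = h" "poly f 1 = 1"
proof -
  obtain M where M: "M \<noteq> 0" "mpoly M h = 0" "\<And>N. N \<noteq> 0 \<Longrightarrow> mpoly N h = 0 \<Longrightarrow> degree M \<le> degree N"
    using ex_has_least_nat[of "\<lambda>p. p \<noteq> 0 \<and> mpoly p h = 0" _ degree] matrix_annihilator[of h] by metis
  have M0: "poly M 0 \<noteq> 0"
  proof
    assume "poly M 0 = 0"
    then obtain N where N: "M = pCons 0 N" by (metis pCons_cases poly_pCons add_0_right mult_zero_left)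
    then have "h ** mpoly N h = 0" using M(2) by (simp add: mat_zero)
    then have "mpoly N h = 0"
      using matrix_inv_cancel_left(2)[OF assms, of "mpoly N h"] by (metis mat_eqI mv_simps(1) matrix_vector_mult_0 matrix_vector_mult_0_right)
    moreover have "N \<noteq> 0" using N M(1) by auto
    ultimately show False using M(3)[of N] N by simp
  qed
  have "M * [:-1, 1:] \<noteq> 0" using M(1) by (simp del: mult_pCons_right)
  moreover have "\<mu> \<noteq> 0" if "poly (M * [:-1, 1:]) \<mu> = 0" for \<mu>
    using that M0 by auto
  ultimately obtain f where "M * [:-1, 1:] dvd f * f - [:0, 1:]"
    using poly_sqrt_mod by blast
  then obtain q where q: "f * f - [:0, 1:] = M * [:-1, 1:] * q" by (auto elim: dvdE)
  have "mpoly (f * f - [:0, 1:]) h = mpoly M h ** mpoly ([:-1, 1:] * q) h"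
    unfolding q by (simp only: mult.assoc mpoly_mult)
  also have "\<dots> = 0" by (rule mat_eqI) (simp add: M(2))
  finally have hh: "mpoly f h ** mpoly f h = h"
    by (intro mat_eqI) (metis (no_types) add_0_left eq_iff_diff_eq_0 mpoly_diff mpoly_mult mpoly_pCons
        mpoly_0 mpoly_1 one_pCons matrix_mul_rid mat_zero)
  have "poly (f * f - [:0, 1:]) 1 = 0" unfolding q by simp
  then have "poly f 1 = 1 \<or> poly f 1 = -1" by (simp add: square_eq_1_iff)
  then show ?thesis
  proof
    assume "poly f 1 = -1"
    moreover have "mpoly (- f) h ** mpoly (- f) h = h"
      using hh by (intro mat_eqI) (metis minus_minus mpoly_minus mv_simps(1,8,9))
    ultimately show ?thesis using that[of "- f"] by simp
  qed (use that hh in blast)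
qed

section \<open>Conjugacy of triples under the general linear group\<close>

text \<open>The matrix \<open>\<Sum> a(A) u \<otimes> \<phi> b(B)\<close> over the pairs \<open>(a, b)\<close> in \<open>L\<close>.  For \<open>B = A\<close>, and if
  the cyclic subspace of \<open>u\<close> is complementary to the common kernel of all \<open>\<phi> b(A)\<close>, a suitable \<open>L\<close> makes it
  the projection onto the former along the latter.  The two
  sides may belong to different triples \<open>(u, \<phi>, A)\<close>; the matrix is then a comparison map between their
  cyclic subspaces, with the same constants.\<close>

definition tau :: "(complex poly \<times> complex poly) list \<Rightarrow>
    'm::finite cmat \<Rightarrow> 'm cvec \<Rightarrow> 'm cmat \<Rightarrow> 'm cvec \<Rightarrow> 'm cmat" where
  "tau L A u B \<phi> = (\<Sum>(a, b)\<leftarrow>L. outer (mpoly a A *v u) (\<phi> v* mpoly b B))"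

lemma tau_simps [simp]:
  "tau [] A u B \<phi> = 0"
  "tau ((a, b) # L) A u B \<phi> = outer (mpoly a A *v u) (\<phi> v* mpoly b B) + tau L A u B \<phi>"
  by (simp_all add: tau_def)

text \<open>A vector to the right of \<open>tau\<close> matters only through the numbers \<open>\<phi> b(B) x\<close>, and a matrix or functional
  to its left only through the values on the vectors \<open>a(A) u\<close>.  This one-sided substitution makes the mixed
  matrices comparable.\<close>

lemma tau_right_cong:
  assumes "\<And>f. dotp \<phi> (mpoly f B *v x) = dotp \<phi>' (mpoly f B' *v x')"
  shows "tau L A u B \<phi> *v x = tau L A u B' \<phi>' *v x'"
  by (induction L) (auto simp: assms)

lemma tau_left_cong:
  fixes M N :: "'m::finite cmat"
  assumes "\<And>f. M *v (mpoly f A *v u) = N *v (mpoly f A' *v u')"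
  shows "M *v (tau L A u B \<phi> *v x) = N *v (tau L A' u' B \<phi> *v x)"
  by (induction L) (auto simp: assms)

lemma dotp_tau_cong:
  assumes "\<And>f. dotp \<psi> (mpoly f A *v u) = dotp \<psi>' (mpoly f A' *v u')"
  shows "dotp \<psi> (tau L A u B \<phi> *v x) = dotp \<psi>' (tau L A' u' B \<phi> *v x)"
  by (induction L) (auto simp: assms)

definition root_poly :: "complex set \<Rightarrow> complex poly" where
  "root_poly \<Lambda> = (\<Prod>\<mu>\<in>\<Lambda>. [:-\<mu>, 1:])"

text \<open>The interpolation polynomial that is \<open>1\<close> at \<open>\<mu>\<close> and \<open>0\<close> at the other points of \<open>\<Lambda>\<close>.\<close>

definition lagrange :: "complex set \<Rightarrow> complex \<Rightarrow> complex poly" where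
  "lagrange \<Lambda> \<mu> = smult (1 / (\<Prod>\<nu>\<in>\<Lambda> - {\<mu>}. \<mu> - \<nu>)) (root_poly (\<Lambda> - {\<mu>}))"

lemma poly_root_poly: "poly (root_poly \<Lambda>) x = (\<Prod>\<mu>\<in>\<Lambda>. x - \<mu>)"
  by (simp add: root_poly_def poly_prod)

lemma degree_root_poly: "finite \<Lambda> \<Longrightarrow> degree (root_poly \<Lambda>) = card \<Lambda>"
  unfolding root_poly_def by (subst degree_prod_eq_sum_degree) auto

lemma sum_lagrange:
  assumes "finite \<Lambda>" "\<Lambda> \<noteq> {}"
  shows "(\<Sum>\<mu>\<in>\<Lambda>. lagrange \<Lambda> \<mu>) = 1"
proof (rule poly_eqI_degree[of \<Lambda>])
  fix x assume x: "x \<in> \<Lambda>"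
  have "poly (lagrange \<Lambda> \<mu>) x = (if \<mu> = x then 1 else 0)" if "\<mu> \<in> \<Lambda>" for \<mu>
    using x that assms(1) by (auto simp: lagrange_def poly_root_poly)
  then show "poly (\<Sum>\<mu>\<in>\<Lambda>. lagrange \<Lambda> \<mu>) x = poly 1 x"
    using x assms(1) by (simp add: poly_sum)
next
  have "degree (lagrange \<Lambda> \<mu>) \<le> card \<Lambda> - 1" if "\<mu> \<in> \<Lambda>" for \<mu>
    using that assms(1) unfolding lagrange_def
    by (intro order_trans[OF degree_smult_le]) (simp add: degree_root_poly)
  then have "degree (\<Sum>\<mu>\<in>\<Lambda>. lagrange \<Lambda> \<mu>) \<le> card \<Lambda> - 1"
    using assms(1) by (intro degree_sum_le) auto
  moreover have "card \<Lambda> > 0" using assms by (simp add: card_gt_0_iff)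
  ultimately show "degree (\<Sum>\<mu>\<in>\<Lambda>. lagrange \<Lambda> \<mu>) < card \<Lambda>" "degree (1 :: complex poly) < card \<Lambda>"
    by auto
qed

lemma root_poly_dvd:
  assumes "finite \<Lambda>" "\<mu> \<in> \<Lambda>"
  shows "root_poly \<Lambda> dvd [:-\<mu>, 1:] * lagrange \<Lambda> \<mu>"
    and "\<nu> \<in> \<Lambda> \<Longrightarrow> \<nu> \<noteq> \<mu> \<Longrightarrow> root_poly \<Lambda> dvd lagrange \<Lambda> \<nu> * lagrange \<Lambda> \<mu>"
proof -
  have r: "root_poly \<Lambda> = [:-\<mu>, 1:] * root_poly (\<Lambda> - {\<mu>})"
    unfolding root_poly_def using assms by (rule prod.remove)
  show "root_poly \<Lambda> dvd [:-\<mu>, 1:] * lagrange \<Lambda> \<mu>"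
    unfolding r lagrange_def mult_smult_right by (rule dvd_smult) simp
  assume \<nu>: "\<nu> \<in> \<Lambda>" "\<nu> \<noteq> \<mu>"
  have "[:-\<mu>, 1:] dvd root_poly (\<Lambda> - {\<nu>})"
    unfolding root_poly_def using assms \<nu> by (intro dvd_prodI) auto
  then show "root_poly \<Lambda> dvd lagrange \<Lambda> \<nu> * lagrange \<Lambda> \<mu>"
    unfolding r lagrange_def by (intro mult_dvd_mono dvd_smult) auto
qed

text \<open>For a projection \<open>P\<close> commuting with \<open>A\<close>, the projection onto the \<open>\<mu>\<close>-eigenspace of \<open>A\<close> in the kernel
  of \<open>P\<close>, provided that \<open>A\<close> is diagonalisable there with eigenvalues in \<open>\<Lambda>\<close>.  As an explicit polynomial
  expression in \<open>A\<close> and \<open>P\<close>, it has a trace that is a polynomial function.\<close>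

definition eigenproj :: "complex set \<Rightarrow> 'm::finite cmat \<Rightarrow> 'm cmat \<Rightarrow> complex \<Rightarrow> 'm cmat" where
  "eigenproj \<Lambda> A P \<mu> = mpoly (lagrange \<Lambda> \<mu>) A ** (mat 1 - P)"

lemma mpoly_sum: "mpoly (\<Sum>i\<in>I. p i) A = (\<Sum>i\<in>I. mpoly (p i) A)"
  by (induction I rule: infinite_finite_induct) simp_all

text \<open>All relations follow from the vanishing on the kernel of \<open>P\<close> of \<open>f(A)\<close> for every multiple \<open>f\<close> of
  \<open>root_poly \<Lambda>\<close>, together with the identity that the Lagrange polynomials add up to \<open>1\<close>.  That identity needs
  \<open>\<Lambda>\<close> nonempty; for empty \<open>\<Lambda>\<close> the kernel of \<open>P\<close> is zero.\<close>

lemma eigenproj_properties: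
  fixes A P :: "'m::finite cmat"
  assumes fin: "finite \<Lambda>" and idem: "\<And>x. P *v (P *v x) = P *v x"
    and comm: "\<And>x. A *v (P *v x) = P *v (A *v x)"
    and ann: "mpoly (root_poly \<Lambda>) A ** (mat 1 - P) = 0"
  shows "\<And>x. P *v (eigenproj \<Lambda> A P \<mu> *v x) = 0"
    and "\<And>x. eigenproj \<Lambda> A P \<mu> *v (P *v x) = 0"
    and "\<And>x. \<mu> \<in> \<Lambda> \<Longrightarrow> A *v (eigenproj \<Lambda> A P \<mu> *v x) = \<mu> *s (eigenproj \<Lambda> A P \<mu> *v x)"
    and "\<And>x. eigenproj \<Lambda> A P \<mu> *v (A *v x) = A *v (eigenproj \<Lambda> A P \<mu> *v x)"
    and "\<And>x. \<mu> \<in> \<Lambda> \<Longrightarrow> \<nu> \<in> \<Lambda> \<Longrightarrow> \<nu> \<noteq> \<mu> \<Longrightarrow>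
      eigenproj \<Lambda> A P \<nu> *v (eigenproj \<Lambda> A P \<mu> *v x) = 0"
    and "\<And>x. (\<Sum>\<mu>\<in>\<Lambda>. eigenproj \<Lambda> A P \<mu> *v x) = x - P *v x"
    and "\<mu> \<in> \<Lambda> \<Longrightarrow> eigenproj \<Lambda> A P \<mu> ** eigenproj \<Lambda> A P \<mu> = eigenproj \<Lambda> A P \<mu>"
proof -
  let ?E = "eigenproj \<Lambda> A P"
  have pc: "P *v (mpoly f A *v x) = mpoly f A *v (P *v x)" for f x
    using mpoly_intertwine[of A P A f x] comm by simp
  have E: "?E \<mu> *v x = mpoly (lagrange \<Lambda> \<mu>) A *v (x - P *v x)" for \<mu> x
    by (simp add: eigenproj_def)
  have E': "?E \<mu> *v x = mpoly (lagrange \<Lambda> \<mu>) A *v x - mpoly (lagrange \<Lambda> \<mu>) A *v (P *v x)" for \<mu> x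
    by (simp add: eigenproj_def)
  show PE: "P *v (?E \<mu> *v x) = 0" for \<mu> x
    by (simp add: E pc idem)
  show EP: "?E \<mu> *v (P *v x) = 0" for \<mu> x by (simp add: E pc idem)
  have dvd0: "mpoly f A *v (x - P *v x) = 0" if d: "root_poly \<Lambda> dvd f" for f x
  proof -
    obtain q where "f = q * root_poly \<Lambda>" using d by (metis dvdE mult.commute)
    then have "mpoly f A *v (x - P *v x) = mpoly q A *v ((mpoly (root_poly \<Lambda>) A ** (mat 1 - P)) *v x)"
      by simp
    then show ?thesis by (simp add: ann del: mv_simps(1))
  qed
  show "A *v (?E \<mu> *v x) = \<mu> *s (?E \<mu> *v x)" if "\<mu> \<in> \<Lambda>" for \<mu> x
  proof -
    have "mpoly ([:-\<mu>, 1:] * lagrange \<Lambda> \<mu>) A *v (x - P *v x) = 0"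
      using root_poly_dvd(1)[OF fin that] by (rule dvd0)
    then have "mpoly [:-\<mu>, 1:] A *v (?E \<mu> *v x) = 0"
      unfolding mpoly_mult mv_simps(1) E .
    then show ?thesis by simp
  qed
  show "?E \<mu> *v (A *v x) = A *v (?E \<mu> *v x)" for \<mu> x
    using mpoly_intertwine[of A A A "lagrange \<Lambda> \<mu>"] by (simp add: E' comm[symmetric])
  show orth: "?E \<nu> *v (?E \<mu> *v x) = 0" if "\<mu> \<in> \<Lambda>" "\<nu> \<in> \<Lambda>" "\<nu> \<noteq> \<mu>" for \<mu> \<nu> x
  proof -
    have "?E \<nu> *v (?E \<mu> *v x) = mpoly (lagrange \<Lambda> \<nu>) A *v (?E \<mu> *v x)"
      by (simp only: E[of \<nu>] PE diff_zero)
    also have "\<dots> = mpoly (lagrange \<Lambda> \<nu> * lagrange \<Lambda> \<mu>) A *v (x - P *v x)"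
      unfolding mpoly_mult mv_simps(1) E ..
    also have "\<dots> = 0" by (rule dvd0) (rule root_poly_dvd(2)[OF fin that])
    finally show ?thesis .
  qed
  show sum: "(\<Sum>\<mu>\<in>\<Lambda>. ?E \<mu> *v x) = x - P *v x" for x
  proof (cases "\<Lambda> = {}")
    case True
    then show ?thesis using dvd0[of 1 x] by (simp add: root_poly_def)
  next
    case False
    have "(\<Sum>\<mu>\<in>\<Lambda>. ?E \<mu> *v x) = mpoly (\<Sum>\<mu>\<in>\<Lambda>. lagrange \<Lambda> \<mu>) A *v (x - P *v x)"
      unfolding E mpoly_sum sum_mv ..
    then show ?thesis by (simp add: sum_lagrange[OF fin False])
  qed
  show "?E \<mu> ** ?E \<mu> = ?E \<mu>" if "\<mu> \<in> \<Lambda>" for \<mu>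
  proof (rule mat_eqI)
    fix x
    have "?E \<mu> *v x = ?E \<mu> *v (x - P *v x)" by (simp add: EP)
    also have "\<dots> = (\<Sum>\<nu>\<in>\<Lambda>. ?E \<mu> *v (?E \<nu> *v x))"
      unfolding sum[symmetric] mv_sum ..
    also have "\<dots> = (\<Sum>\<nu>\<in>\<Lambda>. if \<nu> = \<mu> then ?E \<mu> *v (?E \<mu> *v x) else 0)"
      by (rule sum.cong) (use orth that in auto)
    also have "\<dots> = ?E \<mu> *v (?E \<mu> *v x)" using that fin by simp
    finally show "(?E \<mu> ** ?E \<mu>) *v x = ?E \<mu> *v x" by simp
  qed
qed

text \<open>The triple splits as the cyclic part of \<open>u\<close>, on which \<open>u\<close> and \<open>\<phi>\<close> are in perfect duality, plus a
  complement on which \<open>u\<close> and \<open>\<phi>\<close> vanish and \<open>A\<close> is diagonalisable.  The data \<open>L\<close> and \<open>\<Lambda>\<close> are kept fixed,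
  so that each of the three conditions is a system of polynomial equations in the entries of \<open>u\<close>, \<open>\<phi>\<close>, \<open>A\<close>.\<close>

definition split_triple :: "(complex poly \<times> complex poly) list \<Rightarrow> complex set \<Rightarrow>
    'm::finite cmat \<Rightarrow> 'm cvec \<Rightarrow> 'm cvec \<Rightarrow> bool" where
  "split_triple L \<Lambda> A u \<phi> \<longleftrightarrow>
    (\<forall>f. tau L A u A \<phi> *v (mpoly f A *v u) = mpoly f A *v u) \<and>
    (\<forall>f x. dotp \<phi> (mpoly f A *v (tau L A u A \<phi> *v x)) = dotp \<phi> (mpoly f A *v x)) \<and>
    mpoly (root_poly \<Lambda>) A ** (mat 1 - tau L A u A \<phi>) = 0"

text \<open>Commutation of \<open>A\<close> with the projection \<open>P\<close> is a consequence: both \<open>A P\<close> and \<open>P A\<close> equal \<open>P A P\<close>, the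
  first because the image of \<open>P\<close> is \<open>A\<close>-stable, the second because \<open>P\<close> is built from functionals
  \<open>\<phi> b(A)\<close>, and \<open>\<phi> b(A) A P = \<phi> b(A) A\<close>.\<close>

lemma split_tripleD:
  assumes "split_triple L \<Lambda> A u \<phi>"
  shows "tau L A u A \<phi> *v (mpoly f A *v u) = mpoly f A *v u"
    and "dotp \<phi> (mpoly f A *v (tau L A u A \<phi> *v x)) = dotp \<phi> (mpoly f A *v x)"
    and "tau L A u A \<phi> *v (tau L A u A \<phi> *v x) = tau L A u A \<phi> *v x"
    and "A *v (tau L A u A \<phi> *v x) = tau L A u A \<phi> *v (A *v x)"
    and "mpoly (root_poly \<Lambda>) A ** (mat 1 - tau L A u A \<phi>) = 0"
proof -
  let ?P = "tau L A u A \<phi>"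
  show 1: "?P *v (mpoly f A *v u) = mpoly f A *v u" for f
    using assms by (simp add: split_triple_def)
  show 2: "dotp \<phi> (mpoly f A *v (?P *v x)) = dotp \<phi> (mpoly f A *v x)" for f x
    using assms by (simp add: split_triple_def)
  show "?P *v (?P *v x) = ?P *v x" for x
    by (rule tau_right_cong) (rule 2)
  \<comment> \<open>\<open>P A P = A P\<close>, then \<open>P A P = P A\<close>\<close>
  have "(?P ** A) *v (?P *v x) = A *v (?P *v x)"
  proof (rule tau_left_cong)
    show "(?P ** A) *v (mpoly f A *v u) = A *v (mpoly f A *v u)" for f
      using 1[of "pCons 0 f"] by (simp add: mat_zero)
  qed
  moreover have "?P *v (A *v (?P *v x)) = ?P *v (A *v x)"
  proof (rule tau_right_cong)
    show "dotp \<phi> (mpoly f A *v (A *v (?P *v x))) = dotp \<phi> (mpoly f A *v (A *v x))" for f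
      using 2[of "f * [:0, 1:]" x] by (simp add: mat_zero del: mult_pCons_right)
  qed
  ultimately show "A *v (?P *v x) = ?P *v (A *v x)" by simp
  show "mpoly (root_poly \<Lambda>) A ** (mat 1 - ?P) = 0"
    using assms by (simp add: split_triple_def)
qed

text \<open>When the moments \<open>\<phi> f(A) u\<close> of two split triples agree, the mixed matrix \<open>T\<close> carries \<open>f(A) u\<close> to
  \<open>f(A') u'\<close> and vanishes on the complement.  It is therefore an isomorphism between the cyclic parts,
  with inverse the mixed matrix in the other direction.\<close>

lemma tau_transport:
  assumes s: "split_triple L \<Lambda> A u \<phi>" and s': "split_triple L \<Lambda> A' u' \<phi>'"
    and mom: "\<And>f. dotp \<phi>' (mpoly f A' *v u') = dotp \<phi> (mpoly f A *v u)"
  shows "tau L A' u' A \<phi> *v (mpoly f A *v u) = mpoly f A' *v u'"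
    and "tau L A u A' \<phi>' *v (tau L A' u' A \<phi> *v x) = tau L A u A \<phi> *v x"
    and "dotp \<phi>' (tau L A' u' A \<phi> *v x) = dotp \<phi> x"
    and "tau L A' u' A \<phi> *v (tau L A u A \<phi> *v x) = tau L A' u' A \<phi> *v x"
    and "tau L A' u' A' \<phi>' *v (tau L A' u' A \<phi> *v x) = tau L A' u' A \<phi> *v x"
    and "A' *v (tau L A' u' A \<phi> *v x) = tau L A' u' A \<phi> *v (A *v x)"
proof -
  let ?P = "tau L A u A \<phi>" and ?P' = "tau L A' u' A' \<phi>'"
  let ?T = "tau L A' u' A \<phi>" and ?T' = "tau L A u A' \<phi>'"
  note D = split_tripleD[OF s] and D' = split_tripleD[OF s']
  show T: "?T *v (mpoly f A *v u) = mpoly f A' *v u'" for f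
  proof -
    have "?T *v (mpoly f A *v u) = ?P' *v (mpoly f A' *v u')"
    proof (rule tau_right_cong)
      show "dotp \<phi> (mpoly g A *v (mpoly f A *v u)) = dotp \<phi>' (mpoly g A' *v (mpoly f A' *v u'))" for g
        using mom[of "g * f"] by simp
    qed
    then show ?thesis by (simp add: D'(1))
  qed
  have T': "?T' *v (mpoly f A' *v u') = mpoly f A *v u" for f
  proof -
    have "?T' *v (mpoly f A' *v u') = ?P *v (mpoly f A *v u)"
    proof (rule tau_right_cong)
      show "dotp \<phi>' (mpoly g A' *v (mpoly f A' *v u')) = dotp \<phi> (mpoly g A *v (mpoly f A *v u))" for g
        using mom[of "g * f"] by simp
    qed
    then show ?thesis by (simp add: D(1))
  qed
  have "?T' *v (?T *v x) = mat 1 *v (?P *v x)"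
    by (rule tau_left_cong) (simp add: T')
  then show "?T' *v (?T *v x) = ?P *v x" by simp
  have "dotp \<phi>' (?T *v x) = dotp \<phi> (?P *v x)"
    by (rule dotp_tau_cong) (rule mom)
  then show "dotp \<phi>' (?T *v x) = dotp \<phi> x" using D(2)[of 1 x] by simp
  show TP: "?T *v (?P *v x) = ?T *v x" for x
    by (rule tau_right_cong) (rule D(2))
  have "?P' *v (?T *v x) = mat 1 *v (?T *v x)"
    by (rule tau_left_cong) (simp add: D'(1))
  then show "?P' *v (?T *v x) = ?T *v x" by simp
  have "(?T ** A) *v (?P *v x) = A' *v (?T *v x)"
  proof (rule tau_left_cong)
    show "(?T ** A) *v (mpoly f A *v u) = A' *v (mpoly f A' *v u')" for f
      using T[of "pCons 0 f"] by (simp add: mat_zero)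
  qed
  then have "?T *v (?P *v (A *v x)) = A' *v (?T *v x)" by (simp add: D(4))
  then show "A' *v (?T *v x) = ?T *v (A *v x)" by (simp add: TP)
qed

text \<open>The moments determine the cyclic part up to isomorphism, and on the complement the traces of the
  eigenprojections are the multiplicities of the eigenvalues.  The conjugating matrix is the sum of the
  comparison map \<open>T\<close> of the cyclic parts and of partial isomorphisms \<open>X\<^sub>\<mu>\<close> between the eigenspaces; its inverse
  is the sum of their inverses, as all cross terms vanish.\<close>

theorem split_triples_conjugate:
  fixes A A' :: "'m::finite cmat"
  assumes fin: "finite \<Lambda>" and s: "split_triple L \<Lambda> A u \<phi>" and s': "split_triple L \<Lambda> A' u' \<phi>'"
    and mom: "\<And>f. dotp \<phi>' (mpoly f A' *v u') = dotp \<phi> (mpoly f A *v u)"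
    and tr: "\<And>\<mu>. trace (eigenproj \<Lambda> A' (tau L A' u' A' \<phi>') \<mu>) = trace (eigenproj \<Lambda> A (tau L A u A \<phi>) \<mu>)"
  shows "\<exists>g. invertible g \<and> g *v u = u' \<and> \<phi>' v* g = \<phi> \<and> g ** A = A' ** g"
proof -
  let ?P = "tau L A u A \<phi>" and ?P' = "tau L A' u' A' \<phi>'"
  let ?T = "tau L A' u' A \<phi>" and ?T' = "tau L A u A' \<phi>'"
  let ?E = "eigenproj \<Lambda> A ?P" and ?E' = "eigenproj \<Lambda> A' ?P'"
  note D = split_tripleD[OF s] and D' = split_tripleD[OF s']
  note t = tau_transport[OF s s' mom] and t' = tau_transport[OF s' s mom[symmetric]]
  note e = eigenproj_properties[OF fin D(3) D(4) D(5)]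
    and e' = eigenproj_properties[OF fin D'(3) D'(4) D'(5)]
  have "\<exists>X Y. Y ** X = ?E \<mu> \<and> X ** Y = ?E' \<mu> \<and> ?E' \<mu> ** X = X \<and> X ** ?E \<mu> = X \<and>
      ?E \<mu> ** Y = Y \<and> Y ** ?E' \<mu> = Y" if "\<mu> \<in> \<Lambda>" for \<mu>
    using idempotents_equivalent[OF e(7) e'(7)] that tr by simp
  then obtain X Y where XY: "\<And>\<mu>. \<mu> \<in> \<Lambda> \<Longrightarrow> Y \<mu> ** X \<mu> = ?E \<mu> \<and> X \<mu> ** Y \<mu> = ?E' \<mu> \<and>
      ?E' \<mu> ** X \<mu> = X \<mu> \<and> X \<mu> ** ?E \<mu> = X \<mu> \<and> ?E \<mu> ** Y \<mu> = Y \<mu> \<and> Y \<mu> ** ?E' \<mu> = Y \<mu>"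
    by metis
  define g where "g = ?T + (\<Sum>\<mu>\<in>\<Lambda>. X \<mu>)"
  define h where "h = ?T' + (\<Sum>\<mu>\<in>\<Lambda>. Y \<mu>)"
  have gx: "g *v x = ?T *v x + (\<Sum>\<mu>\<in>\<Lambda>. X \<mu> *v x)" for x by (simp add: g_def sum_mv)
  have hx: "h *v x = ?T' *v x + (\<Sum>\<mu>\<in>\<Lambda>. Y \<mu> *v x)" for x by (simp add: h_def sum_mv)
  have X: "Y \<mu> *v (X \<mu> *v x) = ?E \<mu> *v x" "X \<mu> *v (Y \<mu> *v x) = ?E' \<mu> *v x"
      "?E' \<mu> *v (X \<mu> *v x) = X \<mu> *v x" "X \<mu> *v (?E \<mu> *v x) = X \<mu> *v x"
      "?E \<mu> *v (Y \<mu> *v x) = Y \<mu> *v x" "Y \<mu> *v (?E' \<mu> *v x) = Y \<mu> *v x"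
    if "\<mu> \<in> \<Lambda>" for \<mu> x
    using XY[OF that] by (metis mv_simps(1))+
  \<comment> \<open>\<open>T = T P\<close> while \<open>P\<close> kills the image of \<open>Y\<^sub>\<mu>\<close>, and likewise with the two triples exchanged\<close>
  have T0: "?T *v (Y \<mu> *v x) = 0" "?T' *v (X \<mu> *v x) = 0" if "\<mu> \<in> \<Lambda>" for \<mu> x
    using t(4)[of "Y \<mu> *v x"] t'(4)[of "X \<mu> *v x"] e(1)[of \<mu> "Y \<mu> *v x"] e'(1)[of \<mu> "X \<mu> *v x"]
    by (simp_all add: X[OF that])
  have 0: "X \<mu> *v (?T' *v x) = 0" "Y \<mu> *v (?T *v x) = 0" if "\<mu> \<in> \<Lambda>" for \<mu> x
    using X(4)[OF that, of "?T' *v x"] X(6)[OF that, of "?T *v x"]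
      e(2)[of \<mu> "?T' *v x"] e'(2)[of \<mu> "?T *v x"]
    by (simp_all add: t(5) t'(5))
  have YX: "Y \<nu> *v (X \<mu> *v x) = (if \<nu> = \<mu> then ?E \<mu> *v x else 0)"
      "X \<nu> *v (Y \<mu> *v x) = (if \<nu> = \<mu> then ?E' \<mu> *v x else 0)"
    if "\<mu> \<in> \<Lambda>" "\<nu> \<in> \<Lambda>" for \<mu> \<nu> x
  proof -
    have y: "Y \<nu> *v (X \<mu> *v x) = Y \<nu> *v (?E' \<nu> *v (?E' \<mu> *v (X \<mu> *v x)))"
      and x: "X \<nu> *v (Y \<mu> *v x) = X \<nu> *v (?E \<nu> *v (?E \<mu> *v (Y \<mu> *v x)))"
      by (simp_all add: X that)
    have "Y \<nu> *v (X \<mu> *v x) = 0 \<and> X \<nu> *v (Y \<mu> *v x) = 0" if "\<nu> \<noteq> \<mu>"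
      unfolding y x e(5)[OF \<open>\<mu> \<in> \<Lambda>\<close> \<open>\<nu> \<in> \<Lambda>\<close> that] e'(5)[OF \<open>\<mu> \<in> \<Lambda>\<close> \<open>\<nu> \<in> \<Lambda>\<close> that]
      by simp
    then show "Y \<nu> *v (X \<mu> *v x) = (if \<nu> = \<mu> then ?E \<mu> *v x else 0)"
      "X \<nu> *v (Y \<mu> *v x) = (if \<nu> = \<mu> then ?E' \<mu> *v x else 0)"
      by (auto simp: X(1,2) that)
  qed
  have "h *v (g *v x) = x" for x
  proof -
    have "h *v (g *v x) = ?P *v x + (\<Sum>\<nu>\<in>\<Lambda>. \<Sum>\<mu>\<in>\<Lambda>. if \<nu> = \<mu> then ?E \<mu> *v x else 0)"
      unfolding hx gx by (simp add: mv_sum sum.distrib T0 0 YX t(2) cong: sum.cong)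
    also have "\<dots> = ?P *v x + (\<Sum>\<nu>\<in>\<Lambda>. ?E \<nu> *v x)" using fin by simp
    finally show ?thesis by (simp add: e(6))
  qed
  moreover have "g *v (h *v x) = x" for x
  proof -
    have "g *v (h *v x) = ?P' *v x + (\<Sum>\<nu>\<in>\<Lambda>. \<Sum>\<mu>\<in>\<Lambda>. if \<nu> = \<mu> then ?E' \<mu> *v x else 0)"
      unfolding hx gx by (simp add: mv_sum sum.distrib T0 0 YX t'(2) cong: sum.cong)
    also have "\<dots> = ?P' *v x + (\<Sum>\<nu>\<in>\<Lambda>. ?E' \<nu> *v x)" using fin by simp
    finally show ?thesis by (simp add: e'(6))
  qed
  ultimately have "g ** h = mat 1" "h ** g = mat 1"
    by (auto intro!: mat_eqI)
  then have "invertible g" unfolding invertible_def by blast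
  moreover have "g *v u = u'"
  proof -
    have "?P *v u = u" using D(1)[of 1] by simp
    then have "?E \<mu> *v u = 0" for \<mu> using e(2)[of \<mu> u] by simp
    then have "X \<mu> *v u = 0" if "\<mu> \<in> \<Lambda>" for \<mu> using X(4)[OF that, of u] by simp
    then show ?thesis using t(1)[of 1] by (simp add: gx)
  qed
  moreover have "\<phi>' v* g = \<phi>"
  proof (rule dotp_eqI)
    fix x
    have "dotp \<phi>' (X \<mu> *v x) = 0" if "\<mu> \<in> \<Lambda>" for \<mu>
      using D'(2)[of 1 "X \<mu> *v x"] e'(1)[of \<mu> "X \<mu> *v x"] by (simp add: X[OF that])
    then show "dotp (\<phi>' v* g) x = dotp \<phi> x" by (simp add: gx dotp_sum t(3))
  qed
  moreover have "g ** A = A' ** g"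
  proof (rule mat_eqI)
    fix x
    have "X \<mu> *v (A *v x) = A' *v (X \<mu> *v x)" if "\<mu> \<in> \<Lambda>" for \<mu>
    proof -
      have "X \<mu> *v (A *v x) = X \<mu> *v (A *v (?E \<mu> *v x))"
        using X(4)[OF that, of "A *v x"] by (simp add: e(4))
      also have "\<dots> = \<mu> *s (X \<mu> *v x)" by (simp add: e(3)[OF that] X(4)[OF that])
      also have "\<dots> = A' *v (X \<mu> *v x)" using e'(3)[OF that, of "X \<mu> *v x"] by (simp add: X(3)[OF that])
      finally show ?thesis .
    qed
    then show "(g ** A) *v x = (A' ** g) *v x"
      by (simp add: gx mv_sum t(6))
  qed
  ultimately show ?thesis by blast
qed

section \<open>Zariski closedness of orbits of split triples\<close>

lemma tau_equivariant:
  fixes g :: "'m::finite cmat"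
  assumes "\<And>z. A' *v (g *v z) = g *v (A *v z)" "u' = g *v u" "\<And>z. dotp \<phi>' (g *v z) = dotp \<phi> z"
  shows "tau L A' u' A' \<phi>' *v (g *v z) = g *v (tau L A u A \<phi> *v z)"
  by (induction L) (auto simp: assms mpoly_intertwine[OF assms(1)])

lemma split_triple_equivariant:
  fixes g :: "'m::finite cmat"
  assumes g: "invertible g"
    and A: "\<And>z. A' *v (g *v z) = g *v (A *v z)" and u: "u' = g *v u"
    and \<phi>: "\<And>z. dotp \<phi>' (g *v z) = dotp \<phi> z"
  shows "split_triple L \<Lambda> A u \<phi> \<Longrightarrow> split_triple L \<Lambda> A' u' \<phi>'"
    and "dotp \<phi>' (mpoly f A' *v u') = dotp \<phi> (mpoly f A *v u)"
    and "trace (eigenproj \<Lambda> A' (tau L A' u' A' \<phi>') \<mu>) = trace (eigenproj \<Lambda> A (tau L A u A \<phi>) \<mu>)"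
proof -
  let ?P = "tau L A u A \<phi>" and ?P' = "tau L A' u' A' \<phi>'"
  note t = tau_equivariant[where \<phi>=\<phi> and \<phi>'=\<phi>' and u=u and u'=u', OF A u \<phi>] and m = mpoly_intertwine[OF A]
  have gg: "g *v (matrix_inv g *v x) = x" for x
    using matrix_inv_cancel(1)[OF g] by (metis mv_simps(1) matrix_vector_mul_lid)
  show "dotp \<phi>' (mpoly f A' *v u') = dotp \<phi> (mpoly f A *v u)"
    by (simp add: u m \<phi>)
  show "split_triple L \<Lambda> A' u' \<phi>'" if s: "split_triple L \<Lambda> A u \<phi>"
    unfolding split_triple_def
  proof (intro conjI allI)
    show "?P' *v (mpoly f A' *v u') = mpoly f A' *v u'" for f
    proof -
      have "mpoly f A' *v u' = g *v (mpoly f A *v u)" by (simp add: u m)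
      then show ?thesis using split_tripleD(1)[OF s, of f] t by metis
    qed
    show "dotp \<phi>' (mpoly f A' *v (?P' *v x)) = dotp \<phi>' (mpoly f A' *v x)" for f x
      using split_tripleD(2)[OF s, of f "matrix_inv g *v x"] t[of L "matrix_inv g *v x"]
        m[of f "matrix_inv g *v x"] m[of f "?P *v (matrix_inv g *v x)"] by (simp add: gg \<phi>)
    have "(mpoly (root_poly \<Lambda>) A' ** (mat 1 - ?P')) *v (g *v z)
        = g *v ((mpoly (root_poly \<Lambda>) A ** (mat 1 - ?P)) *v z)" for z
      by (simp add: t m)
    then have "(mpoly (root_poly \<Lambda>) A' ** (mat 1 - ?P')) *v (g *v z) = 0" for z
      using split_tripleD(5)[OF s] by simp
    then have "(mpoly (root_poly \<Lambda>) A' ** (mat 1 - ?P')) *v x = 0" for x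
      using gg by metis
    then show "mpoly (root_poly \<Lambda>) A' ** (mat 1 - ?P') = 0"
      by (intro mat_eqI) (simp del: mv_simps)
  qed
  have e: "eigenproj \<Lambda> A' ?P' \<mu> *v (g *v z) = g *v (eigenproj \<Lambda> A ?P \<mu> *v z)" for z
    by (simp add: eigenproj_def t m)
  have "eigenproj \<Lambda> A' ?P' \<mu> *v x = (g ** eigenproj \<Lambda> A ?P \<mu> ** matrix_inv g) *v x" for x
    using e[of "matrix_inv g *v x"] by (simp only: gg mv_simps(1))
  then have "eigenproj \<Lambda> A' ?P' \<mu> = g ** eigenproj \<Lambda> A ?P \<mu> ** matrix_inv g"
    by (rule mat_eqI)
  then have "trace (eigenproj \<Lambda> A' ?P' \<mu>) = trace (matrix_inv g ** (g ** eigenproj \<Lambda> A ?P \<mu>))"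
    using trace_mul_sym[of "g ** eigenproj \<Lambda> A ?P \<mu>" "matrix_inv g"] by simp
  then show "trace (eigenproj \<Lambda> A' ?P' \<mu>) = trace (eigenproj \<Lambda> A ?P \<mu>)"
    by (simp add: matrix_inv_cancel_left[OF g])
qed

lemma transpose_J: "transpose J = - (J :: 'n::finite mat2)"
proof -
  have "(transpose J) $ i $ j = (- (J :: 'n mat2)) $ i $ j" for i j :: "'n + 'n"
    by (cases i; cases j) (auto simp: J_def transpose_def)
  then show ?thesis by (simp add: vec_eq_iff)
qed

lemma J_mv_J [simp]: "J *v (J *v x) = - (x :: 'n::finite vec2)"
  using J_squared by (metis mv_simps(1,8) matrix_vector_mul_lid)

lemma vec_J: "v v* J = - (J *v (v :: 'n::finite vec2))"
proof -
  have "v v* J = transpose J *v v" by simp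
  then show ?thesis unfolding transpose_J by simp
qed

lemma sigma_theta:
  assumes "invertible (g :: 'n::finite mat2)"
  shows "sp_sigma g *v (sp_theta g *v v) = v"
proof -
  have "sp_sigma g ** sp_theta g = mat 1"
    unfolding sp_theta_def by (simp add: assms invertible_sp_sigma matrix_inv_cancel)
  then show ?thesis by (metis mv_simps(1) matrix_vector_mul_lid)
qed

lemma covector_sigma: "dotp ((sp_sigma M *v v) v* J) x = dotp (v v* J) (M *v (x :: 'n::finite vec2))"
by (simp add: sp_sigma_def inv_J vec_J)

text \<open>The functional \<open>x \<mapsto> \<^sup>tv J x\<close> attached to \<open>v\<close> is transported contragrediently, which identifies the second
  summand with the dual representation.\<close>

lemma covector_theta:
  assumes "invertible (g :: 'n::finite mat2)"
  shows "dotp ((sp_theta g *v v) v* J) (g *v x) = dotp (v v* J) x"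
  using covector_sigma[of g "sp_theta g *v v" x] sigma_theta[OF assms] by simp

lemma covector_inj: "v v* J = w v* J \<Longrightarrow> v = (w :: 'n::finite vec2)"
  by (metis J_mv_J vec_J neg_equal_iff_equal)

definition pvec :: "('n::finite big \<Rightarrow> 'n vec2) \<Rightarrow> bool" where
  "pvec F \<longleftrightarrow> (\<forall>i. poly_fun (\<lambda>x. F x $ i))"

definition pmat :: "('n::finite big \<Rightarrow> 'n mat2) \<Rightarrow> bool" where
  "pmat F \<longleftrightarrow> (\<forall>i j. poly_fun (\<lambda>x. F x $ i $ j))"

lemma poly_fun_sum: "(\<And>i. i \<in> I \<Longrightarrow> poly_fun (F i)) \<Longrightarrow> poly_fun (\<lambda>x. \<Sum>i\<in>I. F i x)"
  by (induction I rule: infinite_finite_induct) (auto intro: poly_fun.intros)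

lemma pvec_coord: "pvec (\<lambda>x :: 'a::finite big. fst (fst x))" "pvec (\<lambda>x :: 'a big. snd (fst x))"
proof -
  have "(\<lambda>x :: 'a big. fst (fst x) $ i) = (\<lambda>((u, v), A). u $ i)"
    "(\<lambda>x :: 'a big. snd (fst x) $ i) = (\<lambda>((u, v), A). v $ i)" for i
    by (auto simp: fun_eq_iff)
  then show "pvec (\<lambda>x :: 'a big. fst (fst x))" "pvec (\<lambda>x :: 'a big. snd (fst x))"
    by (simp_all add: pvec_def poly_fun.coord_u poly_fun.coord_v)
qed

lemma pmat_coord: "pmat (snd :: 'a::finite big \<Rightarrow> _)"
proof -
  have "(\<lambda>x :: 'a big. snd x $ i $ j) = (\<lambda>((u, v), A). A $ i $ j)" for i j
    by (auto simp: fun_eq_iff)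
  then show ?thesis by (simp add: pmat_def poly_fun.coord_A)
qed

lemma pvec_const: "pvec (\<lambda>x. c)" and pmat_const: "pmat (\<lambda>x. C)"
  by (auto simp: pvec_def pmat_def intro: poly_fun.const)

lemma pmat_add: "pmat F \<Longrightarrow> pmat G \<Longrightarrow> pmat (\<lambda>x. F x + G x)"
  by (auto simp: pmat_def intro: poly_fun.add)

lemma poly_fun_diff:
  assumes "poly_fun f" "poly_fun g"
  shows "poly_fun (\<lambda>x. f x - g x)"
  using poly_fun.add[OF assms(1) poly_fun.mult[OF poly_fun.const[of "-1"] assms(2)]] by simp

lemma pmat_diff: "pmat F \<Longrightarrow> pmat G \<Longrightarrow> pmat (\<lambda>x. F x - G x)"
  by (auto simp: pmat_def intro: poly_fun_diff)

lemma pmat_mult: "pmat F \<Longrightarrow> pmat G \<Longrightarrow> pmat (\<lambda>x. F x ** G x)"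
  by (auto simp: pmat_def matrix_matrix_mult_def intro!: poly_fun_sum poly_fun.mult)

lemma pvec_mv: "pmat F \<Longrightarrow> pvec v \<Longrightarrow> pvec (\<lambda>x. F x *v v x)"
  by (auto simp: pmat_def pvec_def matrix_vector_mult_def intro!: poly_fun_sum poly_fun.mult)

lemma pvec_vm: "pmat F \<Longrightarrow> pvec v \<Longrightarrow> pvec (\<lambda>x. v x v* F x)"
  by (auto simp: pmat_def pvec_def vector_matrix_mult_def intro!: poly_fun_sum poly_fun.mult)

lemma pmat_outer: "pvec v \<Longrightarrow> pvec w \<Longrightarrow> pmat (\<lambda>x. outer (v x) (w x))"
  by (auto simp: pmat_def pvec_def outer_def intro!: poly_fun.mult)

lemma poly_fun_dotp: "pvec v \<Longrightarrow> pvec w \<Longrightarrow> poly_fun (\<lambda>x. dotp (v x) (w x))"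
  by (auto simp: pvec_def dotp_def intro!: poly_fun_sum poly_fun.mult)

lemma poly_fun_trace: "pmat F \<Longrightarrow> poly_fun (\<lambda>x. trace (F x))"
  by (auto simp: pmat_def trace_def intro!: poly_fun_sum)

lemma pmat_mpoly: "pmat F \<Longrightarrow> pmat (\<lambda>x. mpoly p (F x))"
  by (induction p) (auto intro!: pmat_add pmat_mult pmat_const)

lemma pmat_tau: "pmat F \<Longrightarrow> pmat G \<Longrightarrow> pvec v \<Longrightarrow> pvec w \<Longrightarrow> pmat (\<lambda>x. tau L (F x) (v x) (G x) (w x))"
  by (induction L) (auto intro!: pmat_add pmat_outer pvec_mv pvec_vm pmat_mpoly pmat_const)

lemmas poly_intros = pvec_coord pmat_coord pvec_const pmat_const pmat_add pmat_diff pmat_mult pvec_mv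
  pvec_vm pmat_outer poly_fun_dotp poly_fun_trace pmat_mpoly pmat_tau

lemma act_components:
  fixes g :: "'n::finite mat2"
  assumes g: "invertible g"
  shows "snd (act g x) *v (g *v z) = g *v (snd x *v z)"
    and "fst (fst (act g x)) = g *v fst (fst x)"
    and "dotp (snd (fst (act g x)) v* J) (g *v z) = dotp (snd (fst x) v* J) z"
proof -
  obtain u v A where x: "x = ((u, v), A)" by (metis surj_pair)
  have "matrix_inv g *v (g *v z) = z"
    using matrix_inv_cancel(2)[OF g] by (metis mv_simps(1) matrix_vector_mul_lid)
  then show "snd (act g x) *v (g *v z) = g *v (snd x *v z)"
    by (simp add: x act_def)
  show "fst (fst (act g x)) = g *v fst (fst x)" by (simp add: x act_def)
  show "dotp (snd (fst (act g x)) v* J) (g *v z) = dotp (snd (fst x) v* J) z"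
    using covector_theta[OF g, of v z] by (simp add: x act_def del: dotp_vm)
qed

text \<open>Splitting with fixed data, together with the values of the moments and traces, amounts to polynomial
  equations.  They hold on the orbit by equivariance, hence on its Zariski closure, and every solution is
  conjugate to the given triple.\<close>

theorem split_orbit_closed:
  fixes u v :: "'n::finite vec2"
  assumes fin: "finite \<Lambda>" and s: "split_triple L \<Lambda> A u (v v* J)"
  shows "closedin zariski (orbit GL act ((u, v), A))"
proof -
  let ?x = "((u, v), A)"
  let ?O = "orbit GL act ?x"
  let ?S = "{f. poly_fun f \<and> (\<forall>y\<in>?O. f y = 0)}"
  have "zero_locus ?S \<subseteq> ?O"
  proof
    fix x' assume x': "x' \<in> zero_locus ?S"
    obtain u' v' A' where x'_eq: "x' = ((u', v'), A')" by (metis surj_pair)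
    have pf: "f x' = c" if "poly_fun f" "\<And>y. y \<in> ?O \<Longrightarrow> f y = c" for f c
      using x' that poly_fun_diff[OF that(1) poly_fun.const[of c]] by (auto simp: zero_locus_def)
    have pm: "F x' = 0" if "pmat F" "\<And>y. y \<in> ?O \<Longrightarrow> F y = 0" for F :: "'n big \<Rightarrow> 'n mat2"
      using that pf[of "\<lambda>x. F x $ i $ j" 0 for i j] by (simp add: vec_eq_iff pmat_def)
    have pv: "F x' = 0" if "pvec F" "\<And>y. y \<in> ?O \<Longrightarrow> F y = 0" for F :: "'n big \<Rightarrow> 'n vec2"
      using that pf[of "\<lambda>x. F x $ i" 0 for i] by (simp add: vec_eq_iff pvec_def)
    let ?A = "\<lambda>y. snd y :: 'n mat2" and ?u = "\<lambda>y. fst (fst y) :: 'n vec2"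
      and ?\<phi> = "\<lambda>y. snd (fst y) v* J :: 'n vec2"
    let ?P = "\<lambda>y. tau L (?A y) (?u y) (?A y) (?\<phi> y)"
    have O: "split_triple L \<Lambda> (?A y) (?u y) (?\<phi> y)"
        "dotp (?\<phi> y) (mpoly f (?A y) *v ?u y) = dotp (v v* J) (mpoly f A *v u)"
        "trace (eigenproj \<Lambda> (?A y) (?P y) \<mu>) = trace (eigenproj \<Lambda> A (tau L A u A (v v* J)) \<mu>)"
      if y: "y \<in> ?O" for y f \<mu>
    proof -
      obtain g where g: "invertible g" "y = act g ?x"
        using y by (auto simp: orbit_def GL_def)
      note e = split_triple_equivariant[OF g(1) act_components[OF g(1), of ?x, folded g(2)]]
      show "split_triple L \<Lambda> (?A y) (?u y) (?\<phi> y)"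
        "dotp (?\<phi> y) (mpoly f (?A y) *v ?u y) = dotp (v v* J) (mpoly f A *v u)"
        "trace (eigenproj \<Lambda> (?A y) (?P y) \<mu>) = trace (eigenproj \<Lambda> A (tau L A u A (v v* J)) \<mu>)"
        using e(1)[of L \<Lambda>] e(2)[of f] e(3)[of \<Lambda> L \<mu>] s by simp_all
    qed
    note D = split_tripleD[OF O(1)]
    have "((?P x' - mat 1) ** mpoly f (?A x')) *v ?u x' = 0" for f
      by (rule pv, intro poly_intros) (simp add: D(1))
    moreover have "dotp (?\<phi> x') ((mpoly f (?A x') ** (?P x' - mat 1)) *v z) = 0" for f z
      by (rule pf, intro poly_intros) (simp add: D(2) del: dotp_vm)
    moreover have "mpoly (root_poly \<Lambda>) (?A x') ** (mat 1 - ?P x') = 0"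
      by (rule pm, intro poly_intros) (rule D(5))
    ultimately have s': "split_triple L \<Lambda> A' u' (v' v* J)"
      by (simp add: split_triple_def x'_eq)
    have "dotp (?\<phi> x') (mpoly f (?A x') *v ?u x') = dotp (v v* J) (mpoly f A *v u)" for f
      by (rule pf, intro poly_intros) (rule O(2))
    then have mom: "dotp (v' v* J) (mpoly f A' *v u') = dotp (v v* J) (mpoly f A *v u)" for f
      by (simp add: x'_eq)
    have "trace (mpoly (lagrange \<Lambda> \<mu>) (?A x') ** (mat 1 - ?P x'))
        = trace (eigenproj \<Lambda> A (tau L A u A (v v* J)) \<mu>)" for \<mu>
      by (rule pf, intro poly_intros) (rule O(3)[unfolded eigenproj_def[of _ "snd _"]])
    then have tr: "trace (eigenproj \<Lambda> A' (tau L A' u' A' (v' v* J)) \<mu>)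
        = trace (eigenproj \<Lambda> A (tau L A u A (v v* J)) \<mu>)" for \<mu>
      by (simp add: x'_eq eigenproj_def[of _ A'])
    obtain g where g: "invertible g" "g *v u = u'" "(v' v* J) v* g = v v* J" "g ** A = A' ** g"
      using split_triples_conjugate[OF fin s s' mom tr] by blast
    have "v' v* J = (sp_theta g *v v) v* J"
    proof (rule dotp_eqI)
      fix x
      have "x = g *v (matrix_inv g *v x)"
        using matrix_inv_cancel(1)[OF g(1)] by (metis mv_simps(1) matrix_vector_mul_lid)
      then show "dotp (v' v* J) x = dotp ((sp_theta g *v v) v* J) x"
        using covector_theta[OF g(1), of v "matrix_inv g *v x"] g(3) by (metis dotp_vm)
    qed
    then have "v' = sp_theta g *v v" by (rule covector_inj)
    moreover have "A' = g ** A ** matrix_inv g"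
      by (simp add: g(4) matrix_mul_assoc[symmetric] matrix_inv_cancel[OF g(1)])
    ultimately have "x' = act g ?x" by (simp add: x'_eq act_def g(2))
    then show "x' \<in> ?O" using g(1) by (auto simp: orbit_def GL_def)
  qed
  moreover have "?O \<subseteq> zero_locus ?S" by (auto simp: zero_locus_def)
  ultimately show ?thesis unfolding closedin_zariski_iff by (intro exI[of _ ?S]) auto
qed

section \<open>The symplectic form and one-parameter degenerations\<close>

definition sform :: "'n::finite vec2 \<Rightarrow> 'n vec2 \<Rightarrow> complex" where
  "sform x y = dotp (x v* J) y"

lemma sform_simps [simp]:
  "sform (x + y) z = sform x z + sform y z" "sform z (x + y) = sform z x + sform z y"
  "sform (x - y) z = sform x z - sform y z" "sform z (x - y) = sform z x - sform z y"
  "sform (c *s x) z = c * sform x z" "sform z (c *s x) = c * sform z x"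
  "sform 0 z = 0" "sform z 0 = 0" "sform (- x) z = - sform x z" "sform z (- x) = - sform z x"
  by (simp_all add: sform_def)

lemma sform_skew: "sform x y = - sform y x"
proof -
  have "sform x y = dotp x (J *v y)" by (simp add: sform_def)
  also have "\<dots> = dotp (- (y v* J)) x" unfolding vec_J by (simp add: dotp_comm)
  finally show ?thesis by (simp add: sform_def)
qed

lemma sform_self [simp]: "sform x x = 0"
  using sform_skew[of x x] by simp

lemma sform_nondegenerate: "(\<And>y. sform x y = 0) \<Longrightarrow> x = 0"
  using covector_inj[of x 0] dotp_eqI[of "x v* J" 0] by (simp add: sform_def del: dotp_vm)

text \<open>Thus \<open>sp_sigma\<close> is the adjoint with respect to the symplectic form.\<close>

lemma sform_sigma: "sform (M *v x) y = sform x (sp_sigma M *v y)"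
proof -
  have "sform (M *v x) y = - sform y (M *v x)" by (rule sform_skew)
  also have "\<dots> = - sform (sp_sigma M *v y) x"
    using covector_sigma[of M y x] by (simp add: sform_def)
  also have "\<dots> = sform x (sp_sigma M *v y)" using sform_skew[of x] by simp
  finally show ?thesis .
qed

lemma mat_eqI_sform:
  fixes M N :: "'n::finite mat2"
  assumes "\<And>x y. sform x (M *v y) = sform x (N *v y)"
  shows "M = N"
proof (rule mat_eqI)
  fix y
  have "sform (M *v y - N *v y) x = 0" for x
    using assms[of x y] sform_skew[of "M *v y - N *v y" x] by simp
  then have "M *v y - N *v y = 0" by (rule sform_nondegenerate)
  then show "M *v y = N *v y" by simp
qed

lemma dotp_J: "dotp (s v* J) x = sform s x" "dotp (s v* J) x = - sform x s"
  using sform_skew[of s x] by (simp_all only: sform_def)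

lemma sp_lie_iff: "A \<in> sp_lie \<longleftrightarrow> (\<forall>x y. sform (A *v x) y = - sform x (A *v y))"
proof -
  have "A \<in> sp_lie \<longleftrightarrow> sp_sigma A = - A" by (simp add: sp_lie_def sp_sigma_def)
  also have "\<dots> \<longleftrightarrow> (\<forall>x y. sform (A *v x) y = - sform x (A *v y))"
    by (auto simp: sform_sigma intro!: mat_eqI_sform)
  finally show ?thesis .
qed

lemma Sp_I:
  fixes g :: "'n::finite mat2"
  assumes "\<And>x y. sform (g *v x) (g *v y) = sform x y"
  shows "g \<in> carrier Sp"
proof -
  have "sp_sigma g ** g = mat 1"
    by (rule mat_eqI_sform) (use assms in \<open>simp add: sform_sigma\<close>)
  moreover from this have "g ** sp_sigma g = mat 1" by (metis matrix_left_right_inverse)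
  ultimately have "invertible g" "matrix_inv (sp_sigma g) = g"
    unfolding invertible_def by (blast, intro matrix_inv_unique)
  then show ?thesis by (simp add: Sp_def GL_def sp_theta_def)
qed

text \<open>When \<open>\<langle>r, s\<rangle> = 1\<close>, the projection onto the orthogonal complement of the hyperbolic plane spanned by \<open>r\<close>
  and \<open>s\<close>, along that plane.\<close>

definition hyp_proj :: "'n::finite vec2 \<Rightarrow> 'n vec2 \<Rightarrow> 'n mat2" where
  "hyp_proj r s = mat 1 + outer r (s v* J) - outer s (r v* J)"

lemma hyp_proj_mv: "hyp_proj r s *v x = x - sform x s *s r - sform r x *s s"
  by (simp add: hyp_proj_def dotp_J(1)[of r] dotp_J(2)[of s] del: dotp_vm)

text \<open>When \<open>\<langle>r, s\<rangle> = 1\<close>, the one-parameter subgroup multiplying \<open>r\<close> by \<open>t\<close>, \<open>s\<close> by \<open>t\<^sup>-\<^sup>1\<close> and fixing the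
  complement of the hyperbolic plane.\<close>

definition torus :: "'n::finite vec2 \<Rightarrow> 'n vec2 \<Rightarrow> complex \<Rightarrow> 'n mat2" where
  "torus r s t = mat 1 - outer ((t - 1) *s r) (s v* J) + outer ((1 / t - 1) *s s) (r v* J)"

lemma torus_mv: "torus r s t *v x = x + ((t - 1) * sform x s) *s r + ((1 / t - 1) * sform r x) *s s"
  by (simp add: torus_def dotp_J(1)[of r] dotp_J(2)[of s] vec_eq_iff algebra_simps del: dotp_vm)

lemma torus_Sp:
  assumes rs: "sform r s = 1" and t: "t \<noteq> 0"
  shows "torus r s t \<in> carrier Sp"
proof (rule Sp_I)
  fix x y
  have "sform s r = -1" "sform x r = - sform r x" "sform s y = - sform y s"
    using rs sform_skew[of s r] sform_skew[of x r] sform_skew[of s y] by simp_all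
  then show "sform (torus r s t *v x) (torus r s t *v y) = sform x y"
    using t by (simp add: torus_mv rs) (simp add: field_simps)
qed

lemma torus_inverse:
  fixes r s :: "'n::finite vec2"
  assumes rs: "sform r s = 1" and t: "t \<noteq> 0"
  shows "matrix_inv (torus r s t) = torus r s (1 / t)"
proof -
  have *: "torus r s t ** torus r s (1 / t) = mat 1" if "t \<noteq> 0" for t
  proof (rule mat_eqI)
    fix x
    let ?a = "sform x s" and ?b = "sform r x"
    define y where "y = torus r s (1 / t) *v x"
    have y: "y = x + ((1 / t - 1) * ?a) *s r + ((t - 1) * ?b) *s s"
      by (simp add: y_def torus_mv)
    have "sform y s = ?a / t" "sform r y = t * ?b"
      by (simp_all add: y rs algebra_simps)
    then have "torus r s t *v y = y + ((t - 1) * (?a / t)) *s r + ((1 / t - 1) * (t * ?b)) *s s"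
      by (simp only: torus_mv)
    also have "\<dots> = x + ((1 / t - 1) * ?a + (t - 1) * (?a / t)) *s r
        + ((t - 1) * ?b + (1 / t - 1) * (t * ?b)) *s s"
      unfolding y by (simp add: vec.scale_left_distrib)
    also have "(1 / t - 1) * ?a + (t - 1) * (?a / t) = 0" using that by (simp add: field_simps)
    also have "(t - 1) * ?b + (1 / t - 1) * (t * ?b) = 0" using that by (simp add: field_simps)
    finally show "(torus r s t ** torus r s (1 / t)) *v x = mat 1 *v x" by (simp add: y_def)
  qed
  show ?thesis
    by (rule matrix_inv_unique) (use *[of t] *[of "1 / t"] t in simp_all)
qed

text \<open>For \<open>\<langle>r, s\<rangle> = 1\<close> and an eigenvector \<open>r\<close> of \<open>A \<in> sp\<close> with eigenvalue \<open>\<alpha>\<close>, this is the limit of the conjugates of \<open>A\<close> by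
  \<open>torus r s t\<close> as \<open>t\<close> tends to \<open>0\<close>: \<open>A\<close> compressed to the complement of the hyperbolic plane, plus \<open>\<alpha>\<close>
  on \<open>r\<close> and \<open>-\<alpha>\<close> on \<open>s\<close>.\<close>

definition limit_mat :: "'n::finite vec2 \<Rightarrow> 'n vec2 \<Rightarrow> complex \<Rightarrow> 'n mat2 \<Rightarrow> 'n mat2" where
  "limit_mat r s \<alpha> A = hyp_proj r s ** A ** hyp_proj r s
     - outer (\<alpha> *s r) (s v* J) - outer (\<alpha> *s s) (r v* J)"

lemma limit_mat_mv:
  "limit_mat r s \<alpha> A *v x = hyp_proj r s *v (A *v (hyp_proj r s *v x))
     + (\<alpha> * sform x s) *s r - (\<alpha> * sform r x) *s s"
  by (simp add: limit_mat_def dotp_J(1)[of r] dotp_J(2)[of s] mult.commute del: dotp_vm)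

lemma hyp_proj_sform:
  "sform (hyp_proj r s *v x) y = sform x (hyp_proj r s *v y)"
  unfolding hyp_proj_mv using sform_skew[of x r] sform_skew[of s y] by simp

lemma limit_mat_sp_lie:
  assumes "A \<in> sp_lie"
  shows "limit_mat r s \<alpha> A \<in> sp_lie"
  unfolding sp_lie_iff
proof (intro allI)
  fix x y
  have "sform (A *v x) y = - sform x (A *v y)" for x y using assms by (simp add: sp_lie_iff)
  then have "sform (hyp_proj r s *v (A *v (hyp_proj r s *v x))) y
      = - sform x (hyp_proj r s *v (A *v (hyp_proj r s *v y)))"
    by (simp add: hyp_proj_sform)
  then show "sform (limit_mat r s \<alpha> A *v x) y = - sform x (limit_mat r s \<alpha> A *v y)"
    unfolding limit_mat_mv using sform_skew[of x r] sform_skew[of s y] by simp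
qed

text \<open>Since \<open>A\<close> preserves the flag \<open>\<langle>r\<rangle> \<subseteq> r\<^sup>\<bottom>\<close>, no negative powers of \<open>t\<close> occur.\<close>

lemma torus_conj:
  fixes A :: "'n::finite mat2"
  assumes A: "A \<in> sp_lie" and r: "A *v r = \<alpha> *s r" and rs: "sform r s = 1" and t: "t \<noteq> 0"
  defines "Q \<equiv> hyp_proj r s"
  shows "torus r s t ** A ** matrix_inv (torus r s t)
    = limit_mat r s \<alpha> A
      + mat t ** (Q ** A ** outer s (r v* J) - outer r (s v* J) ** A ** Q)
      + mat (t ^ 2) ** (outer (sform (A *v s) s *s r) (r v* J))"
    (is "_ = ?R")
proof -
  have Asp: "sform (A *v x) y = - sform x (A *v y)" for x y using A by (simp add: sp_lie_iff)
  have rA: "sform r (A *v x) = - \<alpha> * sform r x" for x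
    using Asp[of r x] r by simp
  have 1: "torus r s t *v x = Q *v x + (t * sform x s) *s r + (1 / t * sform r x) *s s" for t x
    by (simp add: torus_mv Q_def hyp_proj_mv vec_eq_iff algebra_simps)
  have Qr: "Q *v r = 0" "Q *v s = 0" by (simp_all add: Q_def hyp_proj_mv rs)
  have rQ: "sform r (Q *v x) = 0" "sform (Q *v x) s = 0" for x
    by (simp_all add: Q_def hyp_proj_mv rs)
  have "torus r s t *v (A *v (torus r s (1 / t) *v x)) = ?R *v x" for x
  proof -
    let ?a = "sform x s" and ?b = "sform r x"
    define z where "z = A *v (torus r s (1 / t) *v x)"
    have z: "z = A *v (Q *v x) + (\<alpha> * ?a / t) *s r + (t * ?b) *s (A *v s)"
      by (simp add: z_def 1 r mult.commute)
    have "Q *v z = Q *v (A *v (Q *v x)) + (t * ?b) *s (Q *v (A *v s))"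
      "sform z s = sform (A *v (Q *v x)) s + \<alpha> * ?a / t + t * ?b * sform (A *v s) s"
      "sform r z = t * ?b * (- \<alpha>)"
      by (simp_all add: z Qr rQ rA rs)
    then have "torus r s t *v z =
       Q *v (A *v (Q *v x)) + (t * ?b) *s (Q *v (A *v s))
       + (t * (sform (A *v (Q *v x)) s + \<alpha> * ?a / t + t * ?b * sform (A *v s) s)) *s r
       + (1 / t * (t * ?b * (- \<alpha>))) *s s"
      by (simp only: 1)
    also have "\<dots> = ?R *v x"
      using t by (simp add: limit_mat_mv dotp_J(1)[of r] dotp_J(2)[of s] Q_def vec_eq_iff power2_eq_square field_simps del: dotp_vm)
    finally show ?thesis by (simp only: z_def)
  qed
  then show ?thesis
    unfolding torus_inverse[OF rs t] by (intro mat_eqI) simp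
qed

lemma poly_fun_curve:
  fixes f :: "'n::finite big \<Rightarrow> complex"
  assumes "poly_fun f"
  shows "\<exists>p. \<forall>t. f ((a + t *s b, c + t *s d), M + mat t ** N + mat (t ^ 2) ** K) = poly p t"
  using assms
proof induction
  case (const c)
  show ?case by (intro exI[of _ "[:c:]"]) simp
next
  case (coord_u i)
  show ?case by (intro exI[of _ "[:a $ i, b $ i:]"]) simp
next
  case (coord_v i)
  show ?case by (intro exI[of _ "[:c $ i, d $ i:]"]) simp
next
  case (coord_A i j)
  have "(mat t ** N) $ i $ j = t * N $ i $ j" for t and N :: "'n mat2"
    by (simp add: matrix_matrix_mult_def mat_def if_distrib[of "\<lambda>y. y * _"] cong: if_cong)
  then show ?case
    by (intro exI[of _ "[:M $ i $ j, N $ i $ j, K $ i $ j:]"]) (simp add: power2_eq_square algebra_simps)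
next
  case (add f g)
  then show ?case by (metis poly_add)
next
  case (mult f g)
  then show ?case by (metis poly_mult)
qed

text \<open>A polynomial vanishing on the orbit restricts to the curve traced by the one-parameter subgroup as a
  polynomial in \<open>t\<close> with all \<open>t \<noteq> 0\<close> as zeros, so it also vanishes at \<open>t = 0\<close>.  The limit thus lies in the
  orbit.  For \<open>u\<close> the limit exists because \<open>\<langle>r, u\<rangle> = 0\<close> removes the \<open>s\<close>-component.\<close>

theorem closed_orbit_limit:
  fixes A :: "'n::finite mat2"
  assumes A: "A \<in> sp_lie" and r: "A *v r = \<alpha> *s r" and rs: "sform r s = 1" and ru: "sform r u = 0"
    and cl: "closedin (subtopology zariski L_space) (orbit Sp act ((u, - u), A))"
  obtains g where "g \<in> carrier Sp" "hyp_proj r s *v u = g *v u" "limit_mat r s \<alpha> A ** g = g ** A"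
proof -
  let ?O = "orbit Sp act ((u, - u), A)"
  let ?u = "hyp_proj r s *v u" and ?w = "sform u s *s r"
  obtain S where S: "\<And>f. f \<in> S \<Longrightarrow> poly_fun f" "?O = zero_locus S \<inter> L_space"
    using cl unfolding closedin_subtopology closedin_zariski_iff by blast
  define N where "N = hyp_proj r s ** A ** outer s (r v* J) - outer r (s v* J) ** A ** hyp_proj r s"
  define K where "K = outer (sform (A *v s) s *s r) (r v* J)"
  let ?c = "\<lambda>t. ((?u + t *s ?w, - ?u + t *s (- ?w)), limit_mat r s \<alpha> A + mat t ** N + mat (t ^ 2) ** K)"
  have c: "?c t \<in> ?O" if t: "t \<noteq> 0" for t
  proof -
    have "torus r s t *v u = ?u + t *s ?w"
      by (simp add: torus_mv hyp_proj_mv ru vec_eq_iff algebra_simps)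
    moreover have "- (?u + t *s ?w) = - ?u + t *s (- ?w)" by (simp add: vec_eq_iff)
    ultimately have "act (torus r s t) ((u, - u), A) = ?c t"
      unfolding act_Sp[OF torus_Sp[OF rs t]] torus_conj[OF A r rs t] N_def K_def by simp
    then show ?thesis using torus_Sp[OF rs t] unfolding orbit_def by (metis (mono_tags, lifting) mem_Collect_eq)
  qed
  have "f (?c 0) = 0" if fS: "f \<in> S" for f
  proof -
    obtain p where p: "\<And>t. f (?c t) = poly p t"
      using poly_fun_curve[OF S(1)[OF fS]] by metis
    have "poly p t = 0" if "t \<noteq> 0" for t
      using c[OF that] S(2) fS p by (auto simp: zero_locus_def)
    then have "UNIV - {0} \<subseteq> {t. poly p t = 0}" by blast
    moreover have "infinite (UNIV - {0 :: complex})" by (simp add: infinite_UNIV_char_0)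
    ultimately have "p = 0" using poly_roots_finite[of p] finite_subset by blast
    then show ?thesis using p[of 0] by simp
  qed
  then have "?c 0 \<in> zero_locus S" by (simp only: zero_locus_def mem_Collect_eq) blast
  moreover have c0: "?c 0 = ((?u, - ?u), limit_mat r s \<alpha> A)"
    by (simp add: mat_zero)
  ultimately have "((?u, - ?u), limit_mat r s \<alpha> A) \<in> ?O"
    using limit_mat_sp_lie[OF A] unfolding S(2) by (auto simp: L_space_def)
  then obtain g where g: "g \<in> carrier Sp" "((?u, - ?u), limit_mat r s \<alpha> A) = act g ((u, - u), A)"
    by (auto simp: orbit_def)
  then have "?u = g *v u" "limit_mat r s \<alpha> A = g ** A ** matrix_inv g"
    unfolding act_Sp[OF g(1)] by auto
  moreover have "invertible g" using g(1) by (simp add: Sp_def GL_def)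
  ultimately show ?thesis
    using that[OF g(1)] by (simp add: matrix_mul_assoc[symmetric] matrix_inv_cancel)
qed

section \<open>Closed symplectic orbits consist of split triples\<close>

lemma sform_poly_adjoint:
  assumes "A \<in> sp_lie"
  shows "sform (mpoly (pcompose f [:0, -1:]) A *v x) y = sform x (mpoly f A *v y)"
proof (induction f arbitrary: y)
  case (pCons a f)
  have A: "sform (A *v x) y = - sform x (A *v y)" for x y
    using assms by (simp add: sp_lie_iff)
  have "mpoly (pcompose (pCons a f) [:0, -1:]) A *v x
      = a *s x - A *v (mpoly (pcompose f [:0, -1:]) A *v x)"
    by (simp add: pcompose_pCons mat_zero)
  moreover have "mpoly f A *v (A *v y) = A *v (mpoly f A *v y)"
    using mpoly_intertwine[of A A A f y] by simp
  ultimately show ?case using pCons by (simp add: A)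
qed simp

text \<open>On the hyperplane orthogonal to \<open>r\<close>, the projection off the hyperbolic plane has kernel spanned by \<open>r\<close>, and
  it carries \<open>A\<close> to its limit.\<close>

lemma limit_intertwine:
  assumes A: "A \<in> sp_lie" and r: "A *v r = \<alpha> *s r" and rs: "sform r s = 1" and x: "sform r x = 0"
  shows "mpoly f (limit_mat r s \<alpha> A) *v (hyp_proj r s *v x) = hyp_proj r s *v (mpoly f A *v x)"
    and "sform r (mpoly f A *v x) = 0"
proof -
  have rA: "sform r (A *v y) = - \<alpha> * sform r y" for y
    using A r unfolding sp_lie_iff by (metis minus_mult_left minus_minus sform_simps(5))
  show "sform r (mpoly f A *v x) = 0" for f
    by (induction f) (simp_all add: rA x)
  have step: "limit_mat r s \<alpha> A *v (hyp_proj r s *v y) = hyp_proj r s *v (A *v y)" if "sform r y = 0" for y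
  proof -
    have "A *v (hyp_proj r s *v y) = A *v y - (sform y s * \<alpha>) *s r"
      by (simp add: hyp_proj_mv that r)
    moreover have "hyp_proj r s *v (hyp_proj r s *v y) = hyp_proj r s *v y"
      "sform (hyp_proj r s *v y) s = 0" "sform r (hyp_proj r s *v y) = 0" "hyp_proj r s *v r = 0"
      by (simp_all add: hyp_proj_mv rs)
    ultimately show ?thesis by (simp add: limit_mat_mv)
  qed
  show "mpoly f (limit_mat r s \<alpha> A) *v (hyp_proj r s *v x) = hyp_proj r s *v (mpoly f A *v x)"
    by (induction f) (simp_all add: step \<open>\<And>f. sform r (mpoly f A *v x) = 0\<close>)
qed

lemma Sp_injective: "g \<in> carrier Sp \<Longrightarrow> g *v x = 0 \<Longrightarrow> x = 0"
  using matrix_inv_cancel(2)[of g]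
  by (auto simp: Sp_def GL_def) (metis matrix_vector_mul_lid matrix_vector_mult_0_right mv_simps(1))

lemma sform_dual:
  assumes "r \<noteq> 0"
  obtains s where "sform r s = 1"
proof -
  obtain y where "sform r y \<noteq> 0" using sform_nondegenerate assms by blast
  then show ?thesis using that[of "(1 / sform r y) *s y"] by simp
qed

text \<open>The symplectic form is nondegenerate on the cyclic subspace \<open>S\<close> of \<open>u\<close>.  Otherwise its radical, being
  \<open>A\<close>-stable, contains an eigenvector \<open>r\<close>.  The degeneration along \<open>r\<close> stays in the orbit, so its cyclic
  subspace is \<open>g S\<close> for some \<open>g\<close>; but it is also the projection of \<open>S\<close>, which kills \<open>r \<in> S\<close>.\<close>

lemma closed_orbit_nondegenerate:
  fixes A :: "'n::finite mat2"
  assumes A: "A \<in> sp_lie"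
    and cl: "closedin (subtopology zariski L_space) (orbit Sp act ((u, - u), A))"
    and w: "w = mpoly f A *v u" and orth: "\<And>b. sform u (mpoly b A *v w) = 0"
  shows "w = 0"
proof (rule ccontr)
  assume "w \<noteq> 0"
  then obtain q \<alpha> where "mpoly q A *v w \<noteq> 0" and r: "A *v (mpoly q A *v w) = \<alpha> *s (mpoly q A *v w)"
    by (rule eigenvector_from_cyclic)
  define r where "r = mpoly q A *v w"
  have r: "r \<noteq> 0" "A *v r = \<alpha> *s r" "sform r u = 0"
    using \<open>mpoly q A *v w \<noteq> 0\<close> r orth[of q] sform_skew[of r u] by (simp_all add: r_def)
  obtain s where rs: "sform r s = 1" using sform_dual[OF r(1)] .
  obtain g where g: "g \<in> carrier Sp" "hyp_proj r s *v u = g *v u" "limit_mat r s \<alpha> A ** g = g ** A"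
    using closed_orbit_limit[OF A r(2) rs r(3) cl] .
  let ?S = "range (\<lambda>f. mpoly f A *v u)"
  have int: "limit_mat r s \<alpha> A *v (g *v x) = g *v (A *v x)" for x
    using g(3) by (metis mv_simps(1))
  have "vec.subspace ?S"
    unfolding vec.subspace_def
  proof (intro conjI ballI allI)
    show "0 \<in> ?S" by (rule range_eqI[of _ _ 0]) simp
    show "x + y \<in> ?S" if "x \<in> ?S" "y \<in> ?S" for x y
      using that by (auto simp flip: mpoly_add mv_simps(3))
    show "c *s x \<in> ?S" if xS: "x \<in> ?S" for c x
    proof -
      obtain f where "x = mpoly f A *v u" using xS by blast
      then show ?thesis by (intro range_eqI[of _ _ "smult c f"]) simp
    qed
  qed
  moreover have "r \<in> ?S"
    by (rule range_eqI[of _ _ "q * f"]) (simp add: r_def w)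
  moreover have "hyp_proj r s *v r = 0" by (simp add: hyp_proj_mv rs)
  moreover have "(*v) g ` ?S \<subseteq> (*v) (hyp_proj r s) ` ?S"
  proof -
    have "g *v (mpoly f A *v u) = hyp_proj r s *v (mpoly f A *v u)" for f
      using mpoly_intertwine[OF int, of f u] limit_intertwine(1)[OF A r(2) rs r(3), of f] g(2) by simp
    then show ?thesis by auto
  qed
  ultimately show False
    using kernel_vector_shrinks[of ?S r "hyp_proj r s" g] r(1) Sp_injective[OF g(1)] by blast
qed

text \<open>The hypothesis says that \<open>1 - P\<close> maps into the orthogonal complement of the cyclic subspace of \<open>u\<close>.  Let
  \<open>p\<close> be the squarefree polynomial with the roots of an annihilator of \<open>A\<close>.  If \<open>p(A) (1 - P)\<close> is not zero, the
  \<open>A\<close>-stable subspace generated by one of its values contains an eigenvector \<open>r\<close>.  This \<open>r\<close> is orthogonal to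
  \<open>u\<close>, and the degeneration along \<open>r\<close> lowers the rank of \<open>p(A)\<close>: since \<open>p\<close> vanishes at the eigenvalues \<open>\<plusminus>\<alpha>\<close>
  of the limit on the hyperbolic plane, the image of \<open>p\<close> of the limit is contained in the projection of the
  image of \<open>p(A)\<close>, and this projection kills \<open>r\<close>.  On a single orbit, however, the rank is constant.\<close>

lemma closed_orbit_semisimple:
  fixes A P :: "'n::finite mat2"
  assumes A: "A \<in> sp_lie"
    and cl: "closedin (subtopology zariski L_space) (orbit Sp act ((u, - u), A))"
    and P: "\<And>f x. sform u (mpoly f A *v (P *v x)) = sform u (mpoly f A *v x)"
  shows "\<exists>\<Lambda>. finite \<Lambda> \<and> mpoly (root_poly \<Lambda>) A ** (mat 1 - P) = 0"
proof -
  obtain m where m: "m \<noteq> 0" "mpoly m A = 0" using matrix_annihilator[of A] .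
  \<comment> \<open>all roots of an annihilator: this contains \<open>-\<alpha>\<close> along with each eigenvalue \<open>\<alpha>\<close>, by skewness of \<open>A\<close>\<close>
  define \<Lambda> where "\<Lambda> = {z. poly m z = 0}"
  let ?p = "root_poly \<Lambda>"
  have fin: "finite \<Lambda>" using poly_roots_finite[OF m(1)] by (simp add: \<Lambda>_def)
  have root: "poly ?p z = 0" if "poly m z = 0" for z
    using that fin by (auto simp: poly_root_poly \<Lambda>_def)
  have "mpoly ?p A ** (mat 1 - P) = 0"
  proof (rule ccontr)
    assume "mpoly ?p A ** (mat 1 - P) \<noteq> 0"
    then obtain y where y: "(mpoly ?p A ** (mat 1 - P)) *v y \<noteq> 0"
      by (metis mat_eqI matrix_vector_mult_0)
    define w where "w = mpoly ?p A *v (y - P *v y)"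
    have "w \<noteq> 0" using y by (simp add: w_def)
    then obtain q \<alpha> where "mpoly q A *v w \<noteq> 0" and r: "A *v (mpoly q A *v w) = \<alpha> *s (mpoly q A *v w)"
      by (rule eigenvector_from_cyclic)
    define r where "r = mpoly q A *v w"
    have "sform u r = 0"
      using P[of "q * ?p" y] by (simp add: r_def w_def)
    then have r: "r \<noteq> 0" "A *v r = \<alpha> *s r" "sform r u = 0"
      using \<open>mpoly q A *v w \<noteq> 0\<close> r sform_skew[of r u] by (simp_all add: r_def)
    obtain s where rs: "sform r s = 1" using sform_dual[OF r(1)] .
    obtain g where g: "g \<in> carrier Sp" "hyp_proj r s *v u = g *v u" "limit_mat r s \<alpha> A ** g = g ** A"
      using closed_orbit_limit[OF A r(2) rs r(3) cl] .
    let ?B = "limit_mat r s \<alpha> A" and ?S = "range ((*v) (mpoly ?p A))"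
    have int: "?B *v (g *v x) = g *v (A *v x)" for x
      using g(3) by (metis mv_simps(1))
    have rA: "sform r (A *v y) = - \<alpha> * sform r y" for y
      using A r(2) unfolding sp_lie_iff by (metis minus_mult_left minus_minus sform_simps(5))
    have "sform r (mpoly f A *v x) = poly f (- \<alpha>) * sform r x" for f x
      by (induction f) (simp_all add: rA algebra_simps)
    from this[of m s] have "poly m (- \<alpha>) = 0" using m rs by simp
    moreover have "poly m \<alpha> = 0"
      using mpoly_eigen[OF r(2), of m] m(2) r(1) by simp
    moreover have "?B *v r = \<alpha> *s r" "?B *v s = (- \<alpha>) *s s"
      using sform_skew[of s r] by (simp_all add: limit_mat_mv hyp_proj_mv rs)
    ultimately have ps: "mpoly ?p ?B *v r = 0" "mpoly ?p ?B *v s = 0"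
      using mpoly_eigen[of ?B r \<alpha> ?p] mpoly_eigen[of ?B s "- \<alpha>" ?p] root by simp_all
    have im: "mpoly ?p ?B *v x \<in> (*v) (hyp_proj r s) ` ?S" for x
    proof -
      let ?y = "hyp_proj r s *v x"
      have "mpoly ?p ?B *v x = mpoly ?p ?B *v ?y"
        by (simp add: hyp_proj_mv ps)
      also have "?y = hyp_proj r s *v ?y" by (simp add: hyp_proj_mv rs)
      also have "mpoly ?p ?B *v (hyp_proj r s *v ?y) = hyp_proj r s *v (mpoly ?p A *v ?y)"
        by (rule limit_intertwine(1)[OF A r(2) rs]) (simp add: hyp_proj_mv rs)
      finally show ?thesis by blast
    qed
    have "vec.subspace ?S"
      using vec.linear_subspace_image[OF vec.linear_axioms vec.subspace_UNIV] .
    moreover have "r \<in> ?S"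
    proof (rule range_eqI)
      show "r = mpoly ?p A *v (mpoly q A *v (y - P *v y))"
        unfolding r_def w_def by (rule mpoly_mv_commute)
    qed
    moreover have "hyp_proj r s *v r = 0" by (simp add: hyp_proj_mv rs)
    moreover have "(*v) g ` ?S \<subseteq> (*v) (hyp_proj r s) ` ?S"
      using im by (auto simp flip: mpoly_intertwine[OF int])
    ultimately show False
      using kernel_vector_shrinks[of ?S r "hyp_proj r s" g] r(1) Sp_injective[OF g(1)] by blast
  qed
  then show ?thesis using fin by blast
qed

lemma tau_in_cyclic: "\<exists>h. tau L A u B \<phi> *v x = mpoly h A *v u"
proof (induction L)
  case Nil
  then show ?case by (intro exI[of _ 0]) simp
next
  case (Cons ab L)
  obtain a b where ab: "ab = (a, b)" by (cases ab)
  obtain h where "tau L A u B \<phi> *v x = mpoly h A *v u" using Cons by blast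
  then show ?case
    by (intro exI[of _ "smult (dotp \<phi> (mpoly b B *v x)) a + h"]) (simp add: ab)
qed

lemma tau_in_cocyclic:
  "\<exists>k. \<forall>x. dotp \<phi> (mpoly c A *v (tau L A u A \<phi> *v x)) = dotp \<phi> (mpoly k A *v x)"
proof (induction L)
  case Nil
  then show ?case by (intro exI[of _ 0]) simp
next
  case (Cons ab L)
  obtain a b where ab: "ab = (a, b)" by (cases ab)
  obtain k where "\<And>x. dotp \<phi> (mpoly c A *v (tau L A u A \<phi> *v x)) = dotp \<phi> (mpoly k A *v x)"
    using Cons by blast
  then show ?case
    by (intro exI[of _ "smult (dotp \<phi> (mpoly c A *v (mpoly a A *v u))) b + k"]) (simp add: ab)
qed

text \<open>Among the idempotents of the form \<open>tau L A u A \<phi>\<close> take one with largest trace; the trace is at most the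
  dimension.  If some \<open>w\<^sub>0 = f(A) u\<close> were not fixed, then \<open>w = (1 - P) w\<^sub>0\<close> would be detected by some functional
  \<open>\<phi> c(A)\<close>, and adding the rank-one idempotent built from \<open>w\<close> and \<open>\<phi> c(A) (1 - P)\<close> to \<open>P\<close> would raise the
  trace by one.\<close>

lemma cyclic_projection:
  fixes A :: "'m::finite cmat"
  assumes nondeg: "\<And>f. (\<And>b. dotp \<phi> (mpoly b A *v (mpoly f A *v u)) = 0) \<Longrightarrow> mpoly f A *v u = 0"
  obtains L where "\<And>f. tau L A u A \<phi> *v (mpoly f A *v u) = mpoly f A *v u"
proof -
  let ?P = "\<lambda>L. tau L A u A \<phi>"
  define Q where "Q m \<longleftrightarrow> (\<exists>L. ?P L ** ?P L = ?P L \<and> trace (?P L) = of_nat m)" for m :: nat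
  have "Q 0" unfolding Q_def by (rule exI[of _ "[]"]) (simp add: trace_diff_add)
  moreover have "m \<le> CARD('m)" if "Q m" for m
    using that unfolding Q_def by (metis idempotent_trace_bound of_nat_eq_iff)
  ultimately have m: "Q (Greatest Q)" "\<And>k. Q k \<Longrightarrow> k \<le> Greatest Q"
    by (blast intro: GreatestI_nat Greatest_le_nat)+
  define m where "m = Greatest Q"
  note m = m[folded m_def]
  from m(1) obtain L where L: "?P L ** ?P L = ?P L" "trace (?P L) = of_nat m"
    unfolding Q_def by blast
  have PP: "?P L *v (?P L *v x) = ?P L *v x" for x using L(1) by (metis mv_simps(1))
  have "?P L *v (mpoly f A *v u) = mpoly f A *v u" for f
  proof (rule ccontr)
    assume ne: "?P L *v (mpoly f A *v u) \<noteq> mpoly f A *v u"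
    obtain h0 where h0: "?P L *v (mpoly f A *v u) = mpoly h0 A *v u" using tau_in_cyclic by blast
    define h where "h = f - h0"
    define w where "w = mpoly h A *v u"
    have w: "w = mpoly f A *v u - ?P L *v (mpoly f A *v u)" by (simp add: w_def h_def h0)
    then have "w \<noteq> 0" "?P L *v w = 0" using ne by (simp_all add: PP)
    then obtain c where c: "dotp \<phi> (mpoly c A *v w) \<noteq> 0" using nondeg[of h] w_def by blast
    obtain k0 where k0: "\<And>x. dotp \<phi> (mpoly c A *v (?P L *v x)) = dotp \<phi> (mpoly k0 A *v x)"
      using tau_in_cocyclic by blast
    define k where "k = c - k0"
    define d where "d = dotp \<phi> (mpoly k A *v w)"
    have k: "dotp \<phi> (mpoly k A *v x) = dotp \<phi> (mpoly c A *v (x - ?P L *v x))" for x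
      by (simp add: k_def k0)
    have d: "d \<noteq> 0" using c \<open>?P L *v w = 0\<close> by (simp add: d_def k)
    have kP: "dotp \<phi> (mpoly k A *v (?P L *v x)) = 0" for x by (simp add: k PP)
    \<comment> \<open>the normalised summand \<open>w \<otimes> \<phi> k(A) / d\<close>, written as a pair of polynomials\<close>
    let ?L = "(smult (1 / d) h, k) # L"
    have new: "?P ?L *v x = (dotp \<phi> (mpoly k A *v x) / d) *s w + ?P L *v x" for x
      by (simp add: w_def)
    have "?P ?L ** ?P ?L = ?P ?L"
      by (rule mat_eqI)
        (simp add: new PP kP \<open>?P L *v w = 0\<close> d_def[symmetric] d del: tau_simps)
    moreover have "trace (?P ?L) = of_nat (Suc m)"
      using L(2) d by (simp add: trace_diff_add trace_outer w_def[symmetric] d_def[symmetric])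
    ultimately have "Q (Suc m)" unfolding Q_def by blast
    then show False using m(2)[of "Suc m"] by simp
  qed
  then show ?thesis using that by blast
qed

text \<open>The projection \<open>P\<close> fixes the cyclic subspace.  That \<open>\<phi> f(A) (1 - P) = 0\<close> as well follows by adjunction:
  this functional is \<open>\<langle>z, \<cdot>\<rangle>\<close> up to sign for some \<open>z\<close> in the cyclic subspace, and \<open>z\<close> is orthogonal to the
  cyclic subspace, hence zero by nondegeneracy.\<close>

theorem closed_orbit_split:
  fixes A :: "'n::finite mat2"
  assumes A: "A \<in> sp_lie"
    and cl: "closedin (subtopology zariski L_space) (orbit Sp act ((u, - u), A))"
  shows "\<exists>L \<Lambda>. finite \<Lambda> \<and> split_triple L \<Lambda> A u ((- u) v* J)"
proof -
  let ?\<phi> = "(- u) v* J"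
  have \<phi>: "dotp ?\<phi> x = - sform u x" for x using sform_simps(9)[of u x] by (simp add: sform_def)
  note nd = closed_orbit_nondegenerate[OF A cl]
  have "mpoly f A *v u = 0" if "\<And>b. dotp ?\<phi> (mpoly b A *v (mpoly f A *v u)) = 0" for f
    using nd[OF refl, of f] that unfolding \<phi> by simp
  then obtain L where L: "\<And>f. tau L A u A ?\<phi> *v (mpoly f A *v u) = mpoly f A *v u"
    using cyclic_projection[of ?\<phi> A u] by blast
  let ?P = "tau L A u A ?\<phi>"
  have P: "sform u (mpoly f A *v (?P *v x)) = sform u (mpoly f A *v x)" for f x
  proof -
    obtain k0 where k0: "\<And>x. dotp ?\<phi> (mpoly f A *v (?P *v x)) = dotp ?\<phi> (mpoly k0 A *v x)"
      using tau_in_cocyclic by blast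
    define k where "k = f - k0"
    have k: "sform u (mpoly k A *v x) = sform u (mpoly f A *v x) - sform u (mpoly f A *v (?P *v x))" for x
      using k0[of x] unfolding \<phi> by (simp add: k_def)
    let ?n = "\<lambda>f. pcompose f [:0, -1:] :: complex poly"
    let ?z = "mpoly (?n k) A *v u"
    have "sform u (mpoly b A *v ?z) = 0" for b
    proof -
      have "sform u (mpoly b A *v ?z) = sform (mpoly (?n b) A *v u) ?z"
        by (rule sform_poly_adjoint[OF A, symmetric])
      also have "\<dots> = - sform ?z (mpoly (?n b) A *v u)" by (rule sform_skew)
      also have "\<dots> = - sform u (mpoly k A *v (mpoly (?n b) A *v u))"
        by (simp only: sform_poly_adjoint[OF A])
      also have "\<dots> = 0" by (simp add: k L)
      finally show ?thesis .
    qed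
    then have "?z = 0" by (intro nd[OF refl])
    then have "sform u (mpoly k A *v x) = 0"
      using sform_poly_adjoint[OF A, of k u x] by simp
    then show ?thesis by (simp add: k)
  qed
  obtain \<Lambda> where "finite \<Lambda>" "mpoly (root_poly \<Lambda>) A ** (mat 1 - ?P) = 0"
    using closed_orbit_semisimple[OF A cl P] by blast
  moreover have "dotp ?\<phi> (mpoly f A *v (?P *v x)) = dotp ?\<phi> (mpoly f A *v x)" for f x
    unfolding \<phi> P ..
  ultimately have "finite \<Lambda> \<and> split_triple L \<Lambda> A u ?\<phi>"
    unfolding split_triple_def using L by blast
  then show ?thesis by blast
qed

section \<open>Conjugacy under the symplectic group\<close>

text \<open>The element \<open>h = \<sigma>(g) g\<close> measures how far \<open>g\<close> is from being symplectic.  It is self-adjoint and, because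
  both points lie in \<open>L\<close>, it stabilises \<open>x\<close>.  Its square root \<open>k = f(h)\<close>, a polynomial in \<open>h\<close>, inherits both
  properties, and \<open>g k\<^sup>-\<^sup>1\<close> is symplectic with the same effect on \<open>x\<close> as \<open>g\<close>.\<close>

theorem GL_conjugate_imp_Sp_conjugate:
  fixes g :: "'n::finite mat2"
  assumes x: "x \<in> L_space" and y: "act g x \<in> L_space" and g: "invertible g"
  shows "\<exists>k\<in>carrier Sp. act g x = act k x"
proof -
  obtain u A where x_eq: "x = ((u, - u), A)" and A: "A \<in> sp_lie"
    using x by (auto simp: L_space_def)
  obtain u' A' where y_eq: "act g x = ((u', - u'), A')" and A': "A' \<in> sp_lie"
    using y by (auto simp: L_space_def)
  have u: "g *v u = u'" "sp_theta g *v u = u'" and A'_eq: "A' = g ** A ** matrix_inv g"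
    using y_eq by (auto simp: x_eq act_def)
  have gA: "A' *v (g *v z) = g *v (A *v z)" for z
    unfolding A'_eq using matrix_inv_cancel(2)[OF g] by (metis matrix_vector_mul_lid mv_simps(1))
  have skA: "sform (A *v x) y = - sform x (A *v y)" "sform (A' *v x) y = - sform x (A' *v y)" for x y
    using A A' by (simp_all add: sp_lie_iff)
  define h where "h = sp_sigma g ** g"
  have h: "sform a (h *v b) = sform (g *v a) (g *v b)" for a b
    by (simp add: h_def sform_sigma)
  have hs: "sform (h *v a) b = sform a (h *v b)" for a b
    using sform_skew[of "h *v a" b] sform_skew[of "g *v b" "g *v a"] by (simp add: h)
  have "h ** A = A ** h"
  proof (rule mat_eqI_sform)
    fix a b
    have "sform a ((h ** A) *v b) = sform (g *v a) (A' *v (g *v b))" by (simp add: h gA)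
    also have "\<dots> = - sform (g *v (A *v a)) (g *v b)" using skA(2)[of "g *v a" "g *v b"] by (simp add: gA)
    also have "\<dots> = sform a ((A ** h) *v b)" using skA(1)[of a "h *v b"] by (simp add: h[symmetric])
    finally show "sform a ((h ** A) *v b) = sform a ((A ** h) *v b)" .
  qed
  then have hA: "h *v (A *v z) = A *v (h *v z)" for z by (metis mv_simps(1))
  have hu: "h *v u = 1 *s u"
    using sigma_theta[OF g, of u] u by (simp add: h_def)
  have "invertible h" unfolding h_def using g by (intro invertible_mult invertible_sp_sigma)
  then obtain f where f: "mpoly f h ** mpoly f h = h" "poly f 1 = 1"
    by (rule matrix_sqrt_polynomial)
  define k where "k = mpoly f h"
  have kk: "k ** k = h" using f(1) by (simp add: k_def)
  have ku: "k *v u = u" using mpoly_eigen[OF hu, of f] f(2) by (simp add: k_def)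
  have kA: "k *v (A *v z) = A *v (k *v z)" for z
    unfolding k_def by (rule mpoly_intertwine) (rule hA)
  have ks: "sform (k *v a) b = sform a (k *v b)" for a b
  proof -
    have "sform (mpoly p h *v a) b = sform a (mpoly p h *v b)" for p
    proof (induction p arbitrary: b)
      case (pCons c p)
      have "mpoly p h *v (h *v b) = h *v (mpoly p h *v b)"
        using mpoly_intertwine[of h h h p b] by simp
      then show ?case using pCons by (simp add: hs)
    qed simp
    then show ?thesis by (simp add: k_def)
  qed
  have "k ** (k ** matrix_inv h) = mat 1"
    by (simp add: matrix_mul_assoc kk matrix_inv_cancel[OF \<open>invertible h\<close>])
  then have "invertible k" by (metis invertible_right_inverse)
  then have kc: "k *v (matrix_inv k *v z) = z" "matrix_inv k *v (k *v z) = z" for z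
    using matrix_inv_cancel[of k] by (metis matrix_vector_mul_lid mv_simps(1))+
  define g' where "g' = g ** matrix_inv k"
  have "sform (g' *v a) (g' *v b) = sform a b" for a b
  proof -
    have "sform (g' *v a) (g' *v b) = sform (matrix_inv k *v a) (h *v (matrix_inv k *v b))"
      by (simp add: g'_def h)
    also have "\<dots> = sform (matrix_inv k *v a) (k *v b)"
      unfolding kk[symmetric] by (simp add: kc)
    also have "\<dots> = sform a b" by (simp add: ks[symmetric] kc)
    finally show ?thesis .
  qed
  then have g': "g' \<in> carrier Sp" by (rule Sp_I)
  have "matrix_inv k *v u = u" using kc(2)[of u] by (simp add: ku)
  then have "g' *v u = u'" by (simp add: g'_def u)
  moreover have "g' ** A ** matrix_inv g' = A'"
  proof -
    have "matrix_inv k *v (A *v z) = A *v (matrix_inv k *v z)" for z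
      using kA[of "matrix_inv k *v z"] kc by metis
    then have "g' ** A = A' ** g'" by (intro mat_eqI) (simp add: g'_def gA)
    moreover have "invertible g'" using g' by (simp add: Sp_def GL_def)
    ultimately show ?thesis by (simp add: matrix_mul_assoc[symmetric] matrix_inv_cancel)
  qed
  ultimately have "act g' x = act g x"
    unfolding x_eq act_Sp[OF g'] by (simp add: y_eq[unfolded x_eq])
  then show ?thesis using g' by metis
qed

lemma GL_orbit_Int_L:
  fixes x :: "'n::finite big"
  assumes x: "x \<in> L_space"
  shows "orbit GL act x \<inter> L_space = orbit Sp act x"
proof
  show "orbit GL act x \<inter> L_space \<subseteq> orbit Sp act x"
    using GL_conjugate_imp_Sp_conjugate[OF x] by (fastforce simp: orbit_def GL_def)
  show "orbit Sp act x \<subseteq> orbit GL act x \<inter> L_space"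
    using L_space_stable[OF _ x] by (auto simp: orbit_def Sp_def GL_def)
qed

theorem theorem1p1:
  shows "inj_on orbit_map (orbits Sp (L_space :: 'n::finite big set) act) \<and>
    (\<forall>O1 \<in> orbits GL (UNIV :: 'n big set) act.
       O1 \<inter> L_space = {} \<or> O1 \<inter> L_space \<in> orbits Sp L_space act) \<and>
    (\<forall>O1 \<in> orbits Sp (L_space :: 'n big set) act.
       closedin (subtopology zariski L_space) O1 \<longrightarrow> closedin zariski (orbit_map O1))"
proof (intro conjI ballI impI)
  show "inj_on orbit_map (orbits Sp (L_space :: 'n big set) act)"
  proof (rule inj_onI)
    fix O1 O2 :: "'n big set"
    assume "O1 \<in> orbits Sp L_space act" "O2 \<in> orbits Sp L_space act" and eq: "orbit_map O1 = orbit_map O2"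
    then obtain x y where "x \<in> L_space" "O1 = orbit Sp act x" "y \<in> L_space" "O2 = orbit Sp act y"
      by (auto simp: orbits_def)
    then show "O1 = O2" using eq GL_orbit_Int_L orbit_map_orbit by metis
  qed
next
  fix O1 :: "'n big set" assume "O1 \<in> orbits GL UNIV act"
  then obtain z where z: "O1 = orbit GL act z" by (auto simp: orbits_def)
  interpret group_action GL "UNIV :: 'n big set" act by (rule group_action_GL)
  show "O1 \<inter> L_space = {} \<or> O1 \<inter> L_space \<in> orbits Sp L_space act"
  proof (rule disjCI)
    assume "O1 \<inter> L_space \<notin> orbits Sp L_space act"
    moreover have "O1 \<inter> L_space \<in> orbits Sp L_space act" if x: "x \<in> O1" "x \<in> L_space" for x
    proof -
      have "x \<in> orbit GL act z" "z \<in> orbit GL act x"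
        using x z orbit_sym[of z x] by auto
      then have "O1 = orbit GL act x" unfolding z using orbit_trans by blast
      then show ?thesis using GL_orbit_Int_L[OF x(2)] x(2) unfolding orbits_def by blast
    qed
    ultimately show "O1 \<inter> L_space = {}" by blast
  qed
next
  fix O1 :: "'n big set"
  assume "O1 \<in> orbits Sp L_space act" and cl: "closedin (subtopology zariski L_space) O1"
  then obtain u A where O1: "O1 = orbit Sp act ((u, - u), A)" and A: "A \<in> sp_lie"
    by (auto simp: orbits_def L_space_def)
  obtain L \<Lambda> where "finite \<Lambda>" "split_triple L \<Lambda> A u ((- u) v* J)"
    using closed_orbit_split[OF A] cl O1 by blast
  then show "closedin zariski (orbit_map O1)"
    unfolding O1 orbit_map_orbit by (rule split_orbit_closed)
qed

end
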